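(* Let $G$ be a near-triangulation with vertex set $\{x_1,\dots,x_n\}$, let $e=xy$ be an arbitrary edge of the boundary cycle of $G$, and let $\mathbb{F}$ be an arbitrary field. Then for every choice of non-zero elements $a_f,b_f\in\mathbb{F}$ ($f\in E(G-e)$), the polynomial $P=\prod_{f=x_ix_j\in E(G-e),\,i<j}(a_fx_i+b_fx_j)$ contains a non-vanishing monomial $M$ satisfying: (i) $\deg_x(M)=\deg_y(M)=0$; (ii) $\deg_v(M)\le 2$ for every vertex $v$ of the boundary cycle; (iii) $\deg_u(M)\le 4$ for every interior vertex $u$.
   Context: A near-triangulation is a plane graph whose outer face is bounded by a cycle (the boundary cycle) and all of whose bounded faces are triangles; boundary vertices are those on the boundary cycle and the other vertices are interior. Vertices are identified with variables. A monomial is non-vanishing in a polynomial if its coefficient is non-zero. *)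

theory Defs
  imports "HOL-Analysis.Analysis" "HOL-Library.Poly_Mapping"
begin

section \<open>Plane graphs\<close>

text \<open>
  A finite simple graph drawn in the plane: the vertices are points of the plane, an edge is the
  two-element set of its ends, and \<open>\<gamma> f\<close> parametrises the arc that represents the edge \<open>f\<close>.
  The interior of an edge contains no vertex and no point of any other edge.
\<close>

definition plane_graph ::
  "complex set \<Rightarrow> complex set set \<Rightarrow> (complex set \<Rightarrow> real \<Rightarrow> complex) \<Rightarrow> bool" where
  "plane_graph V E \<gamma> \<longleftrightarrow>
     finite V \<and>
     (\<forall>f\<in>E. f \<subseteq> V \<and> card f = 2) \<and>
     (\<forall>f\<in>E. arc (\<gamma> f) \<and> {pathstart (\<gamma> f), pathfinish (\<gamma> f)} = f) \<and>
     (\<forall>f\<in>E. (path_image (\<gamma> f) - f) \<inter> V = {}) \<and>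
     (\<forall>f\<in>E. \<forall>g\<in>E. f \<noteq> g \<longrightarrow> (path_image (\<gamma> f) - f) \<inter> path_image (\<gamma> g) = {})"

definition faces ::
  "complex set \<Rightarrow> complex set set \<Rightarrow> (complex set \<Rightarrow> real \<Rightarrow> complex) \<Rightarrow> complex set set" where
  "faces V E \<gamma> = components (- (V \<union> (\<Union>f\<in>E. path_image (\<gamma> f))))"

definition cycle_edges :: "'v list \<Rightarrow> 'v set set" where
  "cycle_edges C = {{C ! i, C ! (Suc i mod length C)} |i. i < length C}"

text \<open>A cycle is represented by the list of its vertices in cyclic order.\<close>

definition graph_cycle :: "'v set set \<Rightarrow> 'v list \<Rightarrow> bool" where
  "graph_cycle E C \<longleftrightarrow> 3 \<le> length C \<and> distinct C \<and> cycle_edges C \<subseteq> E"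

definition face_bounded_by ::
  "complex set set \<Rightarrow> (complex set \<Rightarrow> real \<Rightarrow> complex) \<Rightarrow> complex set \<Rightarrow> complex list \<Rightarrow> bool" where
  "face_bounded_by E \<gamma> F C \<longleftrightarrow>
     graph_cycle E C \<and> frontier F = (\<Union>f\<in>cycle_edges C. path_image (\<gamma> f))"

definition boundary_cycle ::
  "complex set \<Rightarrow> complex set set \<Rightarrow> (complex set \<Rightarrow> real \<Rightarrow> complex) \<Rightarrow> complex list \<Rightarrow> bool" where
  "boundary_cycle V E \<gamma> C \<longleftrightarrow>
     (\<exists>F\<in>faces V E \<gamma>. \<not> bounded F \<and> face_bounded_by E \<gamma> F C)"

definition near_triangulation ::
  "complex set \<Rightarrow> complex set set \<Rightarrow> (complex set \<Rightarrow> real \<Rightarrow> complex) \<Rightarrow> bool" where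
  "near_triangulation V E \<gamma> \<longleftrightarrow>
     plane_graph V E \<gamma> \<and>
     (\<exists>C. boundary_cycle V E \<gamma> C) \<and>
     (\<forall>F\<in>faces V E \<gamma>. bounded F \<longrightarrow> (\<exists>T. length T = 3 \<and> face_bounded_by E \<gamma> F T))"


section \<open>Edge polynomials\<close>

text \<open>
  Monomials in variables of type \<open>'v\<close> are finitely supported exponent functions
  \<open>'v \<Rightarrow>\<^sub>0 nat\<close>, and polynomials are finitely supported coefficient functions on monomials.
\<close>

type_synonym ('v, 'k) mpolynomial = "('v \<Rightarrow>\<^sub>0 nat) \<Rightarrow>\<^sub>0 'k"

definition Const :: "'k \<Rightarrow> ('v, 'k::zero) mpolynomial" where
  "Const c = Poly_Mapping.single 0 c"

definition Var :: "'v \<Rightarrow> ('v, 'k::zero_neq_one) mpolynomial" where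
  "Var v = Poly_Mapping.single (Poly_Mapping.single v 1) 1"

definition coefficient :: "('v, 'k::zero) mpolynomial \<Rightarrow> ('v \<Rightarrow>\<^sub>0 nat) \<Rightarrow> 'k" where
  "coefficient P M = Poly_Mapping.lookup P M"

definition deg :: "'v \<Rightarrow> ('v \<Rightarrow>\<^sub>0 nat) \<Rightarrow> nat" where
  "deg v M = Poly_Mapping.lookup M v"

text \<open>
  The vertices are \<open>v 1, \<dots>, v n\<close>, and \<open>D\<close> is the edge set over which the product is taken;
  the coefficient \<open>a f\<close> goes to the end of \<open>f\<close> with the smaller index.
\<close>

definition edge_polynomial ::
  "nat \<Rightarrow> (nat \<Rightarrow> 'v) \<Rightarrow> 'v set set \<Rightarrow> ('v set \<Rightarrow> 'k) \<Rightarrow> ('v set \<Rightarrow> 'k) \<Rightarrow>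
   ('v, 'k::field) mpolynomial" where
  "edge_polynomial n v D a b =
     (\<Prod>(i, j) \<in> {(i, j). i \<in> {1..n} \<and> j \<in> {1..n} \<and> i < j \<and> {v i, v j} \<in> D}.
        Const (a {v i, v j}) * Var (v i) + Const (b {v i, v j}) * Var (v j))"

end

theory Submission
  imports Defs
begin

text \<open>
  The proof is Thomassen's induction on the closed disc bounded by a cycle, carried out for
  monomials. Choose the vertex \<open>v\<close> next to \<open>x\<close> on the boundary, \<open>v \<noteq> y\<close>. If a chord leaves \<open>v\<close>, it
  cuts the disc in two; the monomial of the part without \<open>e\<close> avoids both ends of the chord, so by
  homogeneity the product of the two monomials has a coefficient equal to the product of their
  coefficients. Otherwise the triangles at \<open>v\<close> form a fan \<open>x, z\<^sub>1, \<dots>, z\<^sub>k, w\<close>, and deleting \<open>v\<close> leaves a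
  smaller disc with the \<open>z\<^sub>i\<close> on its boundary. If \<open>w \<noteq> y\<close> and that disc has a non-vanishing monomial \<open>M\<close> with
  degree at most 1 in \<open>w\<close> and at most 3 in each \<open>z\<^sub>i\<close> (other bounds as required), then
  \<open>M v w z\<^sub>1 \<dots> z\<^sub>k\<close> works, as each new edge is forced. Otherwise, for the monomial \<open>M\<close> given by
  induction, all \<open>M z\<^sub>i / w\<close> vanish, and \<open>M v\<^sup>2 z\<^sub>1 \<dots> z\<^sub>k\<close> works.
\<close>

section \<open>Coefficients of edge products\<close>

text \<open>A factor carries one coefficient for each end of its edge, so the induction is free of
  any order of the vertices; the order behind \<open>edge_polynomial\<close> is absorbed into
  \<open>c\<close> at the end.\<close>

definition edge_product ::
  "('v set \<Rightarrow> 'v \<Rightarrow> 'k::field) \<Rightarrow> 'v set set \<Rightarrow> ('v, 'k) mpolynomial" where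
  "edge_product c D = (\<Prod>f\<in>D. \<Sum>p\<in>f. Const (c f p) * Var p)"

definition unit_exp :: "'v \<Rightarrow> ('v \<Rightarrow>\<^sub>0 nat)" where
  "unit_exp p = Poly_Mapping.single p 1"

lemma deg_plus [simp]: "deg p (M + N) = deg p M + deg p N"
  by (simp add: deg_def lookup_add)

lemma deg_minus [simp]: "deg p (M - N) = deg p M - deg p N"
  by (simp add: deg_def lookup_minus)

lemma deg_unit: "deg p (unit_exp q) = (if p = q then 1 else 0)"
  by (simp add: deg_def unit_exp_def lookup_single when_def)

lemma deg_zero [simp]: "deg p 0 = 0"
  by (simp add: deg_def)

lemma deg_sum_unit: "finite S \<Longrightarrow> deg p (\<Sum>q\<in>S. unit_exp q) = (if p \<in> S then 1 else 0)"
  by (induction S rule: finite_induct) (auto simp: deg_unit)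

lemma exp_eqI: "(\<And>p. deg p M = deg p N) \<Longrightarrow> M = N"
  by (simp add: deg_def poly_mapping_eqI)

text \<open>Multiplying by a single term only shifts exponents. The case \<open>deg p N = 0\<close>
  is separate because subtraction of exponents is truncated: there \<open>N - unit_exp p\<close>
  equals \<open>N\<close>, while no term of the product reaches \<open>N\<close>.\<close>

lemma coefficient_monom_mult:
  fixes Q :: "('v, 'k::field) mpolynomial"
  shows "coefficient (Const c * Var p * Q) N =
     (if deg p N = 0 then 0 else c * coefficient Q (N - unit_exp p))"
proof -
  have eq: "Const c * Var p = (Poly_Mapping.single (unit_exp p) c :: ('v, 'k) mpolynomial)"
    by (simp add: Const_def Var_def unit_exp_def mult_single)
  have "coefficient (Const c * Var p * Q) N =
      (\<Sum>l. Poly_Mapping.lookup (Poly_Mapping.single (unit_exp p) c) l * (\<Sum>q. Poly_Mapping.lookup Q q when N = l + q))"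
    by (simp add: eq coefficient_def lookup_mult)
  also have "\<dots> = (\<Sum>l. c * (\<Sum>q. Poly_Mapping.lookup Q q when N = l + q) when l = unit_exp p)"
    by (rule Sum_any.cong) (simp add: lookup_single when_def)
  also have "\<dots> = c * (\<Sum>q. Poly_Mapping.lookup Q q when N = unit_exp p + q)"
    by simp
  also have "(\<Sum>q. Poly_Mapping.lookup Q q when N = unit_exp p + q) =
      (if deg p N = 0 then 0 else Poly_Mapping.lookup Q (N - unit_exp p))"
  proof (cases "deg p N = 0")
    case True
    then have "N \<noteq> unit_exp p + q" for q
      by (auto simp: deg_unit)
    then show ?thesis
      using True by simp
  next
    case False
    have "N = unit_exp p + q \<longleftrightarrow> q = N - unit_exp p" for q
    proof
      show "N = unit_exp p + q" if "q = N - unit_exp p"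
        using False by (intro exp_eqI) (auto simp: that deg_unit)
    qed simp
    then show ?thesis
      using False by simp
  qed
  finally show ?thesis
    by (simp add: coefficient_def)
qed

lemma coefficient_empty:
  "coefficient (edge_product c {}) N = (if N = 0 then 1 else 0)"
  by (simp add: edge_product_def coefficient_def lookup_one when_def)

text \<open>Expanding the factor of the new edge lets the edge contribute one of its two ends.
  Together with \<open>coefficient_empty\<close> this recursion yields all later coefficient
  computations.\<close>

lemma coefficient_insert:
  assumes "finite D" "{p, q} \<notin> D" "p \<noteq> q"
  shows "coefficient (edge_product c (insert {p, q} D)) N =
     (if deg p N = 0 then 0
      else c {p, q} p * coefficient (edge_product c D) (N - unit_exp p)) +
     (if deg q N = 0 then 0
      else c {p, q} q * coefficient (edge_product c D) (N - unit_exp q))"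
proof -
  have "edge_product c (insert {p, q} D) =
      Const (c {p, q} p) * Var p * edge_product c D + Const (c {p, q} q) * Var q * edge_product c D"
    using assms by (simp add: edge_product_def algebra_simps)
  then show ?thesis
    using coefficient_monom_mult[of "c {p, q} p" p "edge_product c D" N]
      coefficient_monom_mult[of "c {p, q} q" q "edge_product c D" N]
    by (simp add: coefficient_def lookup_add)
qed

text \<open>With exponent zero at \<open>q\<close> the new edge can only contribute
  \<open>p\<close>, so a single term of the recursion survives and nothing can cancel.\<close>

lemma coefficient_insert_forced:
  assumes "finite D" "{p, q} \<notin> D" "p \<noteq> q" "deg q N = 0"
  shows "coefficient (edge_product c (insert {p, q} D)) (N + unit_exp p) =
     c {p, q} p * coefficient (edge_product c D) N"
  using assms by (simp add: coefficient_insert deg_unit)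

lemma coefficient_insert_nonzero:
  assumes "finite D" "{p, q} \<notin> D" "p \<noteq> q" "coefficient (edge_product c (insert {p, q} D)) N \<noteq> 0"
  obtains r where "r \<in> {p, q}" "deg r N \<noteq> 0" "coefficient (edge_product c D) (N - unit_exp r) \<noteq> 0"
proof -
  have False if "\<forall>r\<in>{p, q}. deg r N = 0 \<or> coefficient (edge_product c D) (N - unit_exp r) = 0"
    using that assms by (auto simp: coefficient_insert split: if_splits)
  then show thesis using that by blast
qed

section \<open>Homogeneity, support and products over disjoint edge sets\<close>

definition graph_edges :: "'v set set \<Rightarrow> bool" where
  "graph_edges D \<longleftrightarrow> finite D \<and> (\<forall>f\<in>D. card f = 2)"

lemma graph_edges_insert:
  "graph_edges (insert f D) \<longleftrightarrow> graph_edges D \<and> card f = 2"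
  by (auto simp: graph_edges_def)

lemma edge_set_induct [consumes 1, case_names empty insert]:
  assumes "graph_edges D" "P {}"
    and "\<And>p q D. graph_edges D \<Longrightarrow> {p, q} \<notin> D \<Longrightarrow> p \<noteq> q \<Longrightarrow> P D \<Longrightarrow> P (insert {p, q} D)"
  shows "P D"
proof -
  have "finite D" using assms(1) by (simp add: graph_edges_def)
  then show ?thesis using assms(1)
  proof (induction D rule: finite_induct)
    case (insert f D)
    then obtain p q where "f = {p, q}" "p \<noteq> q" by (auto simp: graph_edges_def card_2_iff)
    then show ?case using assms(3) insert by (simp add: graph_edges_insert)
  qed (rule assms(2))
qed

definition total_deg :: "('v \<Rightarrow>\<^sub>0 nat) \<Rightarrow> nat" where
  "total_deg N = (\<Sum>p\<in>Poly_Mapping.keys N. Poly_Mapping.lookup N p)"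

lemma total_deg_superset:
  assumes "finite S" "Poly_Mapping.keys N \<subseteq> S"
  shows "total_deg N = (\<Sum>p\<in>S. Poly_Mapping.lookup N p)"
  unfolding total_deg_def
  by (rule sum.mono_neutral_left) (use assms in \<open>auto simp: in_keys_iff\<close>)

lemma total_deg_plus: "total_deg (M + N) = total_deg M + total_deg N"
proof -
  let ?S = "Poly_Mapping.keys M \<union> Poly_Mapping.keys N"
  have "Poly_Mapping.keys (M + N) \<subseteq> ?S" by (rule Poly_Mapping.keys_add)
  then show ?thesis
    by (simp add: total_deg_superset[of ?S] lookup_add sum.distrib)
qed

lemma total_deg_unit: "total_deg (unit_exp p) = 1"
  by (simp add: total_deg_def unit_exp_def)

lemma total_deg_minus_unit:
  assumes "deg p N \<noteq> 0"
  shows "total_deg N = Suc (total_deg (N - unit_exp p))"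
proof -
  have "N = (N - unit_exp p) + unit_exp p"
    using assms by (intro exp_eqI) (auto simp: deg_unit)
  then show ?thesis
    by (metis One_nat_def add_Suc_right add.right_neutral total_deg_plus total_deg_unit)
qed

lemma total_deg_eq_0: "total_deg N = 0 \<longleftrightarrow> N = 0"
  by (auto simp: total_deg_def in_keys_iff intro: poly_mapping_eqI)

text \<open>Each factor is a linear form, so a monomial of the product takes one unit of degree from
  every edge.\<close>

lemma coefficient_homogeneous:
  assumes "graph_edges D" "coefficient (edge_product c D) N \<noteq> 0"
  shows "total_deg N = card D"
  using assms
proof (induction D arbitrary: N rule: edge_set_induct)
  case empty
  then show ?case by (simp add: coefficient_empty total_deg_def split: if_splits)
next
  case (insert p q D)
  have "finite D" using insert by (simp add: graph_edges_def)
  then obtain r where "deg r N \<noteq> 0" "coefficient (edge_product c D) (N - unit_exp r) \<noteq> 0"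
    by (rule coefficient_insert_nonzero[OF _ insert.hyps(2,3) insert.prems])
  then show ?case
    using insert.IH insert.hyps \<open>finite D\<close> by (simp add: total_deg_minus_unit)
qed

lemma coefficient_support:
  assumes "graph_edges D" "coefficient (edge_product c D) N \<noteq> 0" "p \<notin> \<Union>D"
  shows "deg p N = 0"
  using assms
proof (induction D arbitrary: N rule: edge_set_induct)
  case empty
  then show ?case by (simp add: coefficient_empty split: if_splits)
next
  case (insert r q D)
  have "finite D" using insert by (simp add: graph_edges_def)
  then obtain s where s: "s \<in> {r, q}" "coefficient (edge_product c D) (N - unit_exp s) \<noteq> 0"
    by (rule coefficient_insert_nonzero[OF _ insert.hyps(2,3) insert.prems(1)])
  have "deg p (N - unit_exp s) = 0"
    by (rule insert.IH[OF s(2)]) (use insert.prems in simp)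
  then show ?case using insert.prems s(1) by (auto simp: deg_unit)
qed

text \<open>In any factorisation of the monomial, the part taken from \<open>D1\<close> lives on
  vertices where \<open>M2\<close> is zero, so it divides \<open>M1\<close>. By homogeneity the part
  taken from \<open>D2\<close> has the degree of \<open>M2\<close>, which leaves \<open>M1\<close>
  and \<open>M2\<close> as the only possible pair.\<close>

lemma coefficient_Un:
  assumes "graph_edges D1" "graph_edges D2" "D1 \<inter> D2 = {}"
    and "\<And>p. p \<in> \<Union>D1 \<Longrightarrow> deg p M2 = 0"
    and "coefficient (edge_product c D2) M2 \<noteq> 0"
  shows "coefficient (edge_product c (D1 \<union> D2)) (M1 + M2) =
         coefficient (edge_product c D1) M1 * coefficient (edge_product c D2) M2"
  using assms(1,3,4)
proof (induction D1 arbitrary: M1 rule: edge_set_induct)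
  case empty
  \<comment> \<open>Both \<open>M1 + M2\<close> and \<open>M2\<close> have degree
    \<open>card D2\<close>, so nothing is left for \<open>M1\<close>.\<close>
  have "total_deg M1 = 0" if "coefficient (edge_product c D2) (M1 + M2) \<noteq> 0"
    using coefficient_homogeneous[OF assms(2) that] coefficient_homogeneous[OF assms(2,5)]
    by (simp add: total_deg_plus)
  then show ?case by (auto simp: coefficient_empty total_deg_eq_0)
next
  case (insert p q D)
  have fin: "finite D" "finite (D \<union> D2)" using insert assms(2) by (auto simp: graph_edges_def)
  have shift: "M1 + M2 - unit_exp r = (M1 - unit_exp r) + M2" if "deg r M1 \<noteq> 0" for r
    using that by (intro exp_eqI) (auto simp: deg_unit)
  have "deg p M2 = 0" "deg q M2 = 0" using insert.prems by auto
  moreover have "{p, q} \<notin> D \<union> D2" using insert by auto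
  moreover have IH: "coefficient (edge_product c (D \<union> D2)) (M + M2) =
      coefficient (edge_product c D) M * coefficient (edge_product c D2) M2" for M
    using insert by auto
  ultimately show ?case
    using insert.hyps fin by (simp add: coefficient_insert shift distrib_right mult.assoc)
qed

section \<open>Adding a vertex together with its edges\<close>

definition spokes :: "'v \<Rightarrow> 'v set \<Rightarrow> 'v set set" where
  "spokes v Z = (\<lambda>z. {v, z}) ` Z"

lemma spokes_simps [simp]:
  "spokes v {} = {}" "spokes v (insert z Z) = insert {v, z} (spokes v Z)"
  by (auto simp: spokes_def)

lemma graph_edges_Un:
  "graph_edges (D1 \<union> D2) \<longleftrightarrow> graph_edges D1 \<and> graph_edges D2"
  by (auto simp: graph_edges_def)

lemma not_in_spokes: "z \<notin> Z \<Longrightarrow> z \<noteq> v \<Longrightarrow> {v, z} \<notin> spokes v Z"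
  by (auto simp: spokes_def doubleton_eq_iff)

text \<open>Since \<open>v\<close> has exponent zero, every spoke is forced to contribute its outer
  end, and each one multiplies the coefficient by a non-zero constant.\<close>

lemma coefficient_spokes_outward:
  assumes "graph_edges D" "v \<notin> \<Union>D" "finite Z" "v \<notin> Z" "deg v N = 0"
    and "\<And>z. z \<in> Z \<Longrightarrow> c {v, z} z \<noteq> 0"
  shows "coefficient (edge_product c (D \<union> spokes v Z)) (N + (\<Sum>z\<in>Z. unit_exp z)) = 0 \<longleftrightarrow>
         coefficient (edge_product c D) N = 0"
  using assms(3,4,6)
proof (induction Z rule: finite_induct)
  case (insert z Z)
  let ?D = "D \<union> spokes v Z"
  have "finite ?D" using assms(1) insert by (simp add: graph_edges_def spokes_def)
  moreover have "{v, z} \<notin> ?D" using insert assms(2) by (auto simp: not_in_spokes)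
  moreover have "deg v (N + (\<Sum>z\<in>Z. unit_exp z)) = 0"
    using insert assms(5) by (simp add: deg_sum_unit)
  ultimately have "coefficient (edge_product c (insert {z, v} ?D)) (N + (\<Sum>z\<in>Z. unit_exp z) + unit_exp z)
      = c {z, v} z * coefficient (edge_product c ?D) (N + (\<Sum>z\<in>Z. unit_exp z))"
    using insert by (intro coefficient_insert_forced) (auto simp: insert_commute)
  then show ?case
    using insert by (simp add: insert_commute[of z v] add_ac)
qed simp

text \<open>
  The exponent of \<open>v\<close> is one, so exactly one spoke contributes \<open>v\<close>. If it is the spoke at
  \<open>z \<in> Z\<close>, what remains is a coefficient at \<open>M + z - w\<close>, which vanishes by assumption.
\<close>

lemma coefficient_spokes_one_inward:
  assumes "graph_edges D" "v \<notin> \<Union>D" "finite Z" "v \<notin> Z" "w \<notin> Z" "w \<noteq> v" "deg v M = 0"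
    and "\<And>z. z \<in> insert w Z \<Longrightarrow> c {v, z} z \<noteq> 0" "c {v, w} v \<noteq> 0"
    and "coefficient (edge_product c D) M \<noteq> 0"
    and "\<And>z. z \<in> Z \<Longrightarrow> deg w M = 0 \<or> coefficient (edge_product c D) (M + unit_exp z - unit_exp w) = 0"
  shows "coefficient (edge_product c (D \<union> spokes v (insert w Z)))
           (M + unit_exp v + (\<Sum>z\<in>Z. unit_exp z)) \<noteq> 0"
  using assms(3-5,8,11)
proof (induction Z rule: finite_induct)
  case empty
  have "{v, w} \<notin> D" using assms(2) by auto
  \<comment> \<open>If the spoke at \<open>w\<close> contributed \<open>w\<close>, the exponent left
    for \<open>D\<close> would still contain \<open>v\<close>, which no edge of \<open>D\<close>
    meets.\<close>
  have "coefficient (edge_product c D) (M + unit_exp v - unit_exp w) = 0"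
    using coefficient_support[OF assms(1) _ assms(2), where c = c and N = "M + unit_exp v - unit_exp w"]
      assms(6) by (auto simp: deg_unit)
  then show ?case
    using assms(1,6,7,9,10) \<open>{v, w} \<notin> D\<close> by (simp add: coefficient_insert graph_edges_def deg_unit)
next
  case (insert z Z)
  let ?D = "D \<union> spokes v (insert w Z)"
  let ?S = "\<Sum>z\<in>Z. unit_exp z"
  have zw: "z \<noteq> w" "z \<noteq> v" using insert by auto
  have fin: "finite ?D" using assms(1) insert by (simp add: graph_edges_def spokes_def)
  have nin: "{v, z} \<notin> ?D"
    using insert assms(2) zw by (auto simp: not_in_spokes doubleton_eq_iff)
  have v: "deg v (M + ?S + unit_exp z) = 0"
    using insert assms(7) by (simp add: deg_sum_unit deg_unit)
  \<comment> \<open>This is the term in which the spoke at \<open>z\<close> contributes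
    \<open>v\<close>. What remains is zero at \<open>v\<close>, so all other spokes, that at
    \<open>w\<close> included, must contribute their outer ends.\<close>
  have zero: "coefficient (edge_product c ?D) (M + ?S + unit_exp z) = 0"
  proof (cases "deg w M = 0")
    case True
    have "finite (D \<union> spokes v Z)" using fin by simp
    moreover have "{v, w} \<notin> D \<union> spokes v Z"
      using insert assms(2,6) by (auto simp: not_in_spokes)
    moreover have "deg w (M + ?S + unit_exp z) = 0"
      using True insert zw by (simp add: deg_sum_unit deg_unit)
    \<comment> \<open>Here neither end of the spoke at \<open>w\<close> occurs in the
      exponent.\<close>
    ultimately show ?thesis
      using assms(6) v coefficient_insert[of "D \<union> spokes v Z" v w c "M + ?S + unit_exp z"]
      by simp
  next
    case False
    then have "coefficient (edge_product c D) (M + unit_exp z - unit_exp w) = 0"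
      using insert by auto
    moreover have "deg v (M + unit_exp z - unit_exp w) = 0"
      using assms(7) zw by (simp add: deg_unit)
    ultimately have "coefficient (edge_product c ?D)
        (M + unit_exp z - unit_exp w + (\<Sum>z\<in>insert w Z. unit_exp z)) = 0"
      using insert assms(1,2,6) by (subst coefficient_spokes_outward) auto
    \<comment> \<open>\<open>deg w M \<noteq> 0\<close> makes the truncated subtraction exact, so
      the spoke at \<open>w\<close> restores the missing unit.\<close>
    moreover have "M + unit_exp z - unit_exp w + (\<Sum>z\<in>insert w Z. unit_exp z) = M + ?S + unit_exp z"
      using False insert by (intro exp_eqI) (auto simp: deg_unit)
    ultimately show ?thesis by simp
  qed
  have "M + unit_exp v + (\<Sum>z\<in>insert z Z. unit_exp z) - unit_exp z = M + unit_exp v + ?S"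
    and "M + unit_exp v + (\<Sum>z\<in>insert z Z. unit_exp z) - unit_exp v = M + ?S + unit_exp z"
    using insert by (auto intro!: exp_eqI simp: deg_unit)
  moreover have "coefficient (edge_product c ?D) (M + unit_exp v + ?S) \<noteq> 0"
    using insert by auto
  moreover have "c {v, z} z \<noteq> 0" using insert by simp
  ultimately show ?case
    using coefficient_insert[OF fin nin, of c "M + unit_exp v + (\<Sum>z\<in>insert z Z. unit_exp z)"]
      zw zero insert assms(7) by (simp add: insert_commute[of "{v, w}"] deg_unit)
qed

text \<open>The inductive step for a fan: \<open>S\<close> plays the old boundary without
  \<open>v\<close>, and \<open>Z\<close> the vertices that reach the boundary when \<open>v\<close>
  is deleted, where the bound may rise from 2 to 4. The spoke at \<open>x\<close> always contributes
  \<open>v\<close>, so the other spokes together may contribute \<open>v\<close> at most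
  once.\<close>

lemma spokes_exponent:
  assumes D: "graph_edges D" "v \<notin> \<Union>D" and Z: "finite Z" "v \<notin> Z" "x \<notin> Z" "y \<notin> Z" "w \<notin> Z" "S \<inter> Z = {}"
    and neq: "x \<noteq> v" "w \<noteq> v" "y \<noteq> v" "w \<noteq> x" "w \<in> S" "v \<notin> S"
    and c: "\<And>z p. z \<in> insert x (insert w Z) \<Longrightarrow> p \<in> {v, z} \<Longrightarrow> c {v, z} p \<noteq> 0"
    and M: "coefficient (edge_product c D) M \<noteq> 0" "deg x M = 0" "deg y M = 0"
      "\<And>p. p \<in> S \<union> Z \<Longrightarrow> deg p M \<le> 2" "\<And>p. deg p M \<le> 4"
  shows "\<exists>N. coefficient (edge_product c (D \<union> spokes v (insert x (insert w Z)))) N \<noteq> 0 \<and>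
      deg x N = 0 \<and> deg y N = 0 \<and> (\<forall>p\<in>insert v S. deg p N \<le> 2) \<and> (\<forall>p. deg p N \<le> 4)"
proof -
  let ?D = "D \<union> spokes v (insert w Z)"
  have fin: "finite ?D" using D Z by (simp add: graph_edges_def spokes_def)
  have nin: "{v, x} \<notin> ?D" using D(2) Z(3) neq by (auto simp: not_in_spokes doubleton_eq_iff)
  \<comment> \<open>Exponent zero at \<open>x\<close> forces the spoke from \<open>v\<close> to
    \<open>x\<close> to contribute \<open>v\<close>.\<close>
  have last_spoke: "coefficient (edge_product c (D \<union> spokes v (insert x (insert w Z)))) (N + unit_exp v) \<noteq> 0"
    if "coefficient (edge_product c ?D) N \<noteq> 0" "deg x N = 0" for N
  proof -
    have "coefficient (edge_product c (insert {v, x} ?D)) (N + unit_exp v) =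
        c {v, x} v * coefficient (edge_product c ?D) N"
      using coefficient_insert_forced[OF fin nin _ that(2)] neq(1) by metis
    moreover have "insert {v, x} ?D = D \<union> spokes v (insert x (insert w Z))"
      by (simp del: Un_insert_right add: Un_insert_right[symmetric])
    moreover have "c {v, x} v \<noteq> 0" using c[of x v] by simp
    ultimately show ?thesis using that(1) by (simp only: mult_eq_0_iff) simp
  qed
  have v0: "deg v N = 0" if "coefficient (edge_product c D) N \<noteq> 0" for N
    using coefficient_support[OF D(1) that D(2)] .
  show ?thesis
  \<comment> \<open>The first case raises the exponent of \<open>w\<close> by one, hence the bound 1
    there; it is closed to \<open>w = y\<close>, whose exponent must stay zero. The bound 3 on
    \<open>Z\<close> leaves room for one unit from each spoke.\<close>
  proof (cases "w \<noteq> y \<and> (\<exists>N. coefficient (edge_product c D) N \<noteq> 0 \<and> deg x N = 0 \<and> deg y N = 0 \<and>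
      deg w N \<le> 1 \<and> (\<forall>p\<in>S. deg p N \<le> 2) \<and> (\<forall>p\<in>Z. deg p N \<le> 3) \<and> (\<forall>p. deg p N \<le> 4))")
    case True
    then obtain N where N: "coefficient (edge_product c D) N \<noteq> 0" "deg x N = 0" "deg y N = 0"
      "deg w N \<le> 1" "\<And>p. p \<in> S \<Longrightarrow> deg p N \<le> 2" "\<And>p. p \<in> Z \<Longrightarrow> deg p N \<le> 3" "\<And>p. deg p N \<le> 4"
      and wy: "w \<noteq> y" by blast
    let ?N = "N + (\<Sum>z\<in>insert w Z. unit_exp z)"
    have "coefficient (edge_product c ?D) ?N \<noteq> 0"
      using coefficient_spokes_outward[OF D, of "insert w Z" N c] Z neq v0[OF N(1)] c N(1) by auto
    moreover have d: "deg p ?N = deg p N + (if p = w \<or> p \<in> Z then 1 else 0)" for p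
      using Z(1) by (simp only: deg_plus deg_sum_unit finite_insert insert_iff)
    ultimately have "coefficient (edge_product c (D \<union> spokes v (insert x (insert w Z)))) (?N + unit_exp v) \<noteq> 0"
      using Z(3) neq(4) N(2) by (intro last_spoke) auto
    moreover have "deg p (?N + unit_exp v) \<le> 2" if "p \<in> insert v S" for p
    proof (cases "p = v")
      case True
      then show ?thesis using d[of v] v0[OF N(1)] Z(2) neq(2) by (simp only: deg_plus deg_unit) simp
    next
      case False
      then have "p \<in> S" "p \<notin> Z" using that Z(6) by auto
      then show ?thesis using d[of p] N(4) N(5)[of p] False by (simp only: deg_plus deg_unit) auto
    qed
    moreover have "deg p (?N + unit_exp v) \<le> 4" for p
      using d[of p] N(4) N(6)[of p] N(7)[of p] v0[OF N(1)] neq(2) Z(2)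
      by (simp only: deg_plus deg_unit) (auto split: if_splits)
    moreover have "deg x (?N + unit_exp v) = 0" "deg y (?N + unit_exp v) = 0"
      using d[of x] d[of y] N(2,3) Z(3,4) neq wy by (simp_all only: deg_plus deg_unit) auto
    ultimately show ?thesis by blast
  next
    case no: False
    let ?N = "M + unit_exp v + (\<Sum>z\<in>Z. unit_exp z)"
    \<comment> \<open>Otherwise \<open>M z / w\<close> would meet all bounds of the first case:
      \<open>w\<close> drops from at most 2 to at most 1, and \<open>z\<close> rises from at most 2
      to at most 3. If \<open>w = y\<close>, its exponent is zero at once.\<close>
    have "deg w M = 0 \<or> coefficient (edge_product c D) (M + unit_exp z - unit_exp w) = 0" if z: "z \<in> Z" for z
    proof (rule ccontr)
      assume "\<not> ?thesis"
      then have *: "deg w M \<noteq> 0" "coefficient (edge_product c D) (M + unit_exp z - unit_exp w) \<noteq> 0" by auto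
      then have "w \<noteq> y" using M(3) by auto
      moreover have "deg p (M + unit_exp z - unit_exp w) =
          (if p = w then deg p M - 1 else if p = z then deg p M + 1 else deg p M)" for p
        using z Z(5) by (auto simp: deg_unit)
      moreover have "deg w M \<le> 2" "deg z M \<le> 2" "x \<noteq> z" "y \<noteq> z" "z \<notin> S"
        using M(4)[of w] M(4)[of z] neq z Z by auto
      ultimately have "deg x (M + unit_exp z - unit_exp w) = 0 \<and> deg y (M + unit_exp z - unit_exp w) = 0 \<and>
          deg w (M + unit_exp z - unit_exp w) \<le> 1 \<and>
          (\<forall>p\<in>S. deg p (M + unit_exp z - unit_exp w) \<le> 2) \<and>
          (\<forall>p\<in>Z. deg p (M + unit_exp z - unit_exp w) \<le> 3) \<and>
          (\<forall>p. deg p (M + unit_exp z - unit_exp w) \<le> 4)"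
        using M(2-5) by (force simp del: deg_plus deg_minus simp: le_diff_conv le_SucI)
      then show False using no * \<open>w \<noteq> y\<close> by blast
    qed
    then have "coefficient (edge_product c ?D) ?N \<noteq> 0"
      using coefficient_spokes_one_inward[OF D Z(1,2,5) neq(2) v0[OF M(1)], of c] c M(1) by auto
    \<comment> \<open>The 2 at \<open>v\<close> counts the forced spoke at \<open>x\<close> and the
      one unit that comes from the spokes at \<open>w\<close> and \<open>Z\<close>.\<close>
    moreover have d: "deg p (?N + unit_exp v) = deg p M + (if p = v then 2 else 0) + (if p \<in> Z then 1 else 0)" for p
      using Z(1) by (simp add: deg_unit deg_sum_unit)
    have dx: "deg x ?N = 0" using Z(1,3) neq M(2) by (simp add: deg_unit deg_sum_unit)
    ultimately have "coefficient (edge_product c (D \<union> spokes v (insert x (insert w Z)))) (?N + unit_exp v) \<noteq> 0"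
      by (intro last_spoke)
    moreover have "deg p (?N + unit_exp v) \<le> 2" if "p \<in> insert v S" for p
    proof (cases "p = v")
      case True
      then show ?thesis unfolding d using v0[OF M(1)] Z(2) by simp
    next
      case False
      then have "p \<in> S" "p \<notin> Z" using that Z(6) by auto
      then show ?thesis unfolding d using M(4)[of p] False by simp
    qed
    moreover have "deg p (?N + unit_exp v) \<le> 4" for p
      unfolding d using M(4)[of p] M(5)[of p] v0[OF M(1)] Z(2) by auto
    moreover have "deg x (?N + unit_exp v) = 0" "deg y (?N + unit_exp v) = 0"
      unfolding d using M(2,3) Z(3,4) neq by auto
    ultimately show ?thesis by blast
  qed
qed

section \<open>Paths and cycles in plane graphs\<close>

fun path_edges :: "'v list \<Rightarrow> 'v set set" where
  "path_edges (a # b # L) = insert {a, b} (path_edges (b # L))"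
| "path_edges _ = {}"

lemma path_edges_append:
  "path_edges (A @ w # B) = path_edges (A @ [w]) \<union> path_edges (w # B)"
  by (induction A rule: path_edges.induct) auto

lemma path_edges_rev: "path_edges (rev L) = path_edges L"
proof (induction L rule: path_edges.induct)
  case (1 a b L)
  then show ?case by (simp add: path_edges_append[of _ b "[a]"] insert_commute)
qed auto

lemma path_edges_subset: "f \<in> path_edges L \<Longrightarrow> f \<subseteq> set L"
  by (induction L rule: path_edges.induct) auto

lemma Union_path_edges: "2 \<le> length L \<Longrightarrow> \<Union>(path_edges L) = set L"
proof (induction L rule: path_edges.induct)
  case (1 a b L)
  then show ?case by (cases L) auto
qed auto

lemma path_edges_nth: "path_edges L = {{L ! i, L ! Suc i} |i. Suc i < length L}"
proof (induction L rule: path_edges.induct)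
  case (1 a b L)
  have "{{(a # b # L) ! i, (a # b # L) ! Suc i} |i. Suc i < length (a # b # L)} =
      insert {a, b} {{(b # L) ! i, (b # L) ! Suc i} |i. Suc i < length (b # L)}" (is "?l = ?r")
  proof
    show "?l \<subseteq> ?r"
    proof
      fix f assume "f \<in> ?l"
      then obtain i where "f = {(a # b # L) ! i, (a # b # L) ! Suc i}" "Suc i < length (a # b # L)"
        by blast
      then show "f \<in> ?r" by (cases i) auto
    qed
    show "?r \<subseteq> ?l"
    proof
      fix f assume "f \<in> ?r"
      then consider "f = {a, b}" |
        i where "f = {(b # L) ! i, (b # L) ! Suc i}" "Suc i < length (b # L)" by blast
      then show "f \<in> ?l"
      proof cases
        case 1
        then show ?thesis by (auto intro!: exI[of _ 0])
      next
        case 2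
        then show ?thesis by (auto intro!: exI[of _ "Suc i"])
      qed
    qed
  qed
  then show ?case using 1 by simp
qed auto

text \<open>Repeating the first vertex at the end replaces the index taken modulo the length, and
  makes a cycle a closed path.\<close>

lemma cycle_edges_Cons: "cycle_edges (a # L) = path_edges (a # L @ [a])"
proof -
  have "(a # L) ! (Suc i mod length (a # L)) = (a # L @ [a]) ! Suc i" if "i < length (a # L)" for i
    using that by (cases "i = length L") (auto simp: nth_append)
  moreover have "(a # L) ! i = (a # L @ [a]) ! i" if "i < length (a # L)" for i
    using that by (cases i) (auto simp: nth_append)
  ultimately show ?thesis
    unfolding cycle_edges_def path_edges_nth by (intro Collect_cong) (metis append_Cons length_append_singleton length_Cons Suc_less_eq)
qed

lemma cycle_edges_split:
  "cycle_edges (u # A @ w # B) = path_edges (u # A @ [w]) \<union> path_edges (w # B @ [u])"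
  using path_edges_append[of "u # A" w "B @ [u]"] by (simp add: cycle_edges_Cons)

lemma cycle_edges_rotate: "cycle_edges (A @ B) = cycle_edges (B @ A)"
proof (cases "A = [] \<or> B = []")
  case False
  then obtain a A' b B' where "A = a # A'" "B = b # B'" by (metis list.exhaust)
  then show ?thesis
    using cycle_edges_split[of a A' b B'] cycle_edges_split[of b B' a A'] by auto
qed auto

lemma Union_cycle_edges: "\<Union>(cycle_edges C) = set C"
proof (cases C)
  case (Cons a L)
  then show ?thesis using Union_path_edges[of "a # L @ [a]"] by (auto simp: cycle_edges_Cons)
qed (simp add: cycle_edges_def)

text \<open>The first vertex of a simple path lies on the first edge only, so that edge must already
  end at the last vertex.\<close>

lemma path_edge_ends:
  assumes "distinct (u # A @ [w])" "{u, w} \<in> path_edges (u # A @ [w])"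
  shows "A = []"
proof (cases A)
  case (Cons a A')
  then have "u \<notin> set (A @ [w])" "{u, w} \<noteq> {u, a}" using assms(1) by (auto simp: doubleton_eq_iff)
  then show ?thesis using assms(2) path_edges_subset[of "{u, w}" "A @ [w]"] by (auto simp: Cons)
qed

lemma path_edges_card:
  "distinct L \<Longrightarrow> f \<in> path_edges L \<Longrightarrow> card f = 2"
  by (induction L rule: path_edges.induct) auto

text \<open>A common edge would join the only two common vertices \<open>u\<close> and
  \<open>w\<close>, which makes both halves a single edge; the second hypothesis excludes this
  double edge.\<close>

lemma cycle_halves_disjoint:
  assumes "distinct (u # A @ w # B)" "A \<noteq> [] \<or> B \<noteq> []"
  shows "path_edges (u # A @ [w]) \<inter> path_edges (w # B @ [u]) = {}"
proof (rule ccontr)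
  assume "\<not> ?thesis"
  then obtain f where f: "f \<in> path_edges (u # A @ [w])" "f \<in> path_edges (w # B @ [u])" by blast
  then have "f \<subseteq> {u, w}" using path_edges_subset assms(1) by fastforce
  moreover have "card f = 2" using f(1) assms(1) by (intro path_edges_card[of "u # A @ [w]"]) auto
  then obtain p q where "f = {p, q}" "p \<noteq> q" by (auto simp: card_2_iff)
  ultimately have "f = {u, w}" by auto
  then show False
    using f path_edge_ends[of u A w] path_edge_ends[of w B u] assms by (auto simp: insert_commute)
qed

lemma graph_cycle_rotate: "graph_cycle E (A @ B) \<longleftrightarrow> graph_cycle E (B @ A)"
  by (auto simp: graph_cycle_def cycle_edges_rotate[of A B])

text \<open>The inverse of the arc would embed a non-empty open set of the plane into the line,
  against invariance of dimension.\<close>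

lemma interior_arc_image:
  fixes g :: "real \<Rightarrow> complex"
  assumes "arc g"
  shows "interior (path_image g) = {}"
proof (rule ccontr)
  assume ne: "interior (path_image g) \<noteq> {}"
  obtain h where h: "homeomorphism {0..1} (path_image g) g h"
    using homeomorphism_arc[OF assms] by blast
  have "continuous_on (interior (path_image g)) h"
    using h interior_subset[of "path_image g"] by (auto simp: homeomorphism_def intro: continuous_on_subset)
  moreover have "inj_on h (interior (path_image g))"
    using h interior_subset[of "path_image g"] by (intro inj_on_inverseI[of _ g]) (auto simp: homeomorphism_def)
  ultimately have "DIM(complex) \<le> DIM(real)"
    using ne by (intro invariance_of_dimension) auto
  then show False by simp
qed

lemma interior_finite_Union_closed:
  assumes "finite \<F>" "\<And>X. X \<in> \<F> \<Longrightarrow> closed X" "\<And>X. X \<in> \<F> \<Longrightarrow> interior X = {}"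
  shows "interior (\<Union>\<F>) = {}"
  using assms
proof (induction \<F> rule: finite_induct)
  case (insert X \<F>)
  then show ?case by (simp add: interior_closed_Un_empty_interior)
qed auto

section \<open>Drawn edges and paths\<close>

locale plane_embedding =
  fixes V :: "complex set" and E :: "complex set set" and \<gamma> :: "complex set \<Rightarrow> real \<Rightarrow> complex"
  assumes plane: "plane_graph V E \<gamma>"
begin

abbreviation "img f \<equiv> path_image (\<gamma> f)"

definition "curve D = (\<Union>f\<in>D. img f)"

lemma finite_vertices: "finite V" using plane by (simp add: plane_graph_def)

lemma edge_props:
  assumes "f \<in> E"
  shows "f \<subseteq> V" "card f = 2" "arc (\<gamma> f)" "{pathstart (\<gamma> f), pathfinish (\<gamma> f)} = f"
    "(img f - f) \<inter> V = {}"
  using plane assms by (auto simp: plane_graph_def)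

lemma finite_edges: "finite E"
proof -
  have "E \<subseteq> Pow V" using edge_props by auto
  then show ?thesis using finite_vertices finite_subset by blast
qed

lemma edges_cross: "f \<in> E \<Longrightarrow> g \<in> E \<Longrightarrow> f \<noteq> g \<Longrightarrow> (img f - f) \<inter> img g = {}"
  using plane by (simp add: plane_graph_def)

lemma ends_in_img: "f \<in> E \<Longrightarrow> f \<subseteq> img f"
  using edge_props(4)[of f] pathstart_in_path_image[of "\<gamma> f"] pathfinish_in_path_image[of "\<gamma> f"]
  by (metis empty_subsetI insert_subset)

text \<open>The open edge is the image of the open unit interval. Connectedness will put it on one
  side of a cycle that it avoids, and density carries this over to the closed edge.\<close>

lemma open_edge:
  assumes "f \<in> E"
  shows "connected (img f - f)" "img f - f \<noteq> {}" "img f \<subseteq> closure (img f - f)"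
proof -
  have sp: "simple_path (\<gamma> f)" using edge_props(3)[OF assms] by (rule arc_imp_simple_path)
  have eq: "img f - f = img f - {pathstart (\<gamma> f), pathfinish (\<gamma> f)}"
    using edge_props(4)[OF assms] by simp
  show "connected (img f - f)" "img f - f \<noteq> {}"
    unfolding eq using connected_simple_path_endless[OF sp] nonempty_simple_path_endless[OF sp] by auto
  have "\<gamma> f ` closure {0<..<1} \<subseteq> closure (\<gamma> f ` {0<..<1})"
    using simple_path_imp_path[OF sp] closure_subset[of "\<gamma> f ` {0<..<1}"]
    by (intro image_closure_subset) (auto simp: path_def)
  then show "img f \<subseteq> closure (img f - f)"
    unfolding eq simple_path_endless[OF sp] by (simp add: path_image_def)
qed

lemma closed_img: "f \<in> E \<Longrightarrow> closed (img f)"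
  by (simp add: edge_props(3) closed_arc_image)

lemma curve_Un: "curve (D1 \<union> D2) = curve D1 \<union> curve D2"
  by (auto simp: curve_def)

lemma ends_in_curve: "D \<subseteq> E \<Longrightarrow> \<Union>D \<subseteq> curve D"
  unfolding curve_def using ends_in_img by blast

text \<open>A point on two different edges must be an end of both, which reduces intersections of
  curves to a matter of vertex sets.\<close>

lemma curve_Int:
  assumes "D1 \<subseteq> E" "D2 \<subseteq> E" "D1 \<inter> D2 = {}"
  shows "curve D1 \<inter> curve D2 = \<Union>D1 \<inter> \<Union>D2"
proof
  show "curve D1 \<inter> curve D2 \<subseteq> \<Union>D1 \<inter> \<Union>D2"
  proof
    fix p assume "p \<in> curve D1 \<inter> curve D2"
    then obtain f g where fg: "f \<in> D1" "g \<in> D2" "p \<in> img f" "p \<in> img g" by (auto simp: curve_def)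
    then have "f \<in> E" "g \<in> E" "f \<noteq> g" using assms by auto
    then have "p \<in> f" "p \<in> g" using fg edges_cross[of f g] edges_cross[of g f] by auto
    then show "p \<in> \<Union>D1 \<inter> \<Union>D2" using fg by auto
  qed
  show "\<Union>D1 \<inter> \<Union>D2 \<subseteq> curve D1 \<inter> curve D2"
    using ends_in_curve assms by blast
qed

lemma open_edge_curve:
  assumes "f \<in> E" "D \<subseteq> E" "f \<notin> D"
  shows "(img f - f) \<inter> curve D = {}"
proof -
  have "(img f - f) \<inter> img g = {}" if "g \<in> D" for g
    using that assms by (intro edges_cross) auto
  then show ?thesis by (auto simp: curve_def)
qed

lemma vertices_on_curve:
  assumes "D \<subseteq> E"
  shows "V \<inter> curve D = \<Union>D"
proof
  show "V \<inter> curve D \<subseteq> \<Union>D"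
  proof
    fix p assume "p \<in> V \<inter> curve D"
    then obtain f where "f \<in> D" "p \<in> img f" "p \<in> V" by (auto simp: curve_def)
    then show "p \<in> \<Union>D" using edge_props(5)[of f] assms by blast
  qed
  show "\<Union>D \<subseteq> V \<inter> curve D" using ends_in_curve[OF assms] edge_props(1) assms by blast
qed

text \<open>Edges are joined one at a time; as the vertices are distinct, the new edge meets the
  rest only in the joining vertex, so the join is again an arc.\<close>

lemma path_arc:
  assumes "distinct L" "2 \<le> length L" "path_edges L \<subseteq> E"
  shows "\<exists>g. arc g \<and> pathstart g = hd L \<and> pathfinish g = last L \<and> path_image g = curve (path_edges L)"
  using assms
proof (induction L rule: path_edges.induct)
  case (1 a b L)
  have "{a, b} \<in> E" using 1 by simp
  note e = edge_props[OF this]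
  \<comment> \<open>\<open>\<gamma> {a, b}\<close> may run either way, and is reversed if it starts
    at \<open>b\<close>.\<close>
  obtain h where h: "arc h" "pathstart h = a" "pathfinish h = b" "path_image h = img {a, b}"
  proof (cases "pathstart (\<gamma> {a, b}) = a")
    case True
    then have "pathfinish (\<gamma> {a, b}) = b" using e(4) by (metis doubleton_eq_iff)
    then show ?thesis using that True e(3) by blast
  next
    case False
    then have "pathstart (\<gamma> {a, b}) = b" "pathfinish (\<gamma> {a, b}) = a"
      using e(4) by (metis doubleton_eq_iff)+
    then show ?thesis using that[of "reversepath (\<gamma> {a, b})"] e(3) by (simp add: arc_reversepath)
  qed
  show ?case
  proof (cases L)
    case Nil
    then show ?thesis using h by (auto simp: curve_def)
  next
    case (Cons c L')
    then obtain g where g: "arc g" "pathstart g = b" "pathfinish g = last (b # L)"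
        "path_image g = curve (path_edges (b # L))"
      using 1 by auto
    have "{a, b} \<notin> path_edges (b # L)" using path_edges_subset[of "{a, b}" "b # L"] 1 by auto
    then have "curve {{a, b}} \<inter> curve (path_edges (b # L)) = {a, b} \<inter> set (b # L)"
      using curve_Int[of "{{a, b}}" "path_edges (b # L)"] Union_path_edges[of "b # L"] 1 Cons by auto
    then have "path_image h \<inter> path_image g \<subseteq> {b}"
      using g h 1 by (auto simp: curve_def)
    then have "arc (h +++ g)" using h g by (intro arc_join) auto
    moreover have "path_image (h +++ g) = curve (path_edges (a # b # L))"
      using h g by (simp add: path_image_join curve_def)
    ultimately show ?thesis using h g Cons by (intro exI[of _ "h +++ g"]) auto
  qed
qed auto

section \<open>The region bounded by a cycle and its division by a path\<close>

definition "cimg C = curve (cycle_edges C)"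

definition "disc C = cimg C \<union> inside (cimg C)"

text \<open>Each near-triangulation of the induction is given by the edges in the closed region of a
  cycle. The embedding stays fixed, so its faces never have to be recomputed.\<close>

definition "inner_edges C = {f \<in> E. img f \<subseteq> disc C}"

lemma cycle_halves:
  assumes "graph_cycle E (u # A @ w # B)"
  shows "path_edges (u # A @ [w]) \<subseteq> E" "path_edges (w # B @ [u]) \<subseteq> E"
    "path_edges (u # A @ [w]) \<inter> path_edges (w # B @ [u]) = {}"
    "curve (path_edges (u # A @ [w])) \<inter> curve (path_edges (w # B @ [u])) = {u, w}"
    "cimg (u # A @ w # B) = curve (path_edges (u # A @ [w])) \<union> curve (path_edges (w # B @ [u]))"
proof -
  have C: "distinct (u # A @ w # B)" "A \<noteq> [] \<or> B \<noteq> []" "cycle_edges (u # A @ w # B) \<subseteq> E"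
    using assms by (auto simp: graph_cycle_def)
  show E: "path_edges (u # A @ [w]) \<subseteq> E" "path_edges (w # B @ [u]) \<subseteq> E"
    using C(3) by (auto simp: cycle_edges_split)
  show disj: "path_edges (u # A @ [w]) \<inter> path_edges (w # B @ [u]) = {}"
    using cycle_halves_disjoint[OF C(1,2)] .
  show "curve (path_edges (u # A @ [w])) \<inter> curve (path_edges (w # B @ [u])) = {u, w}"
    using curve_Int[OF E disj] Union_path_edges[of "u # A @ [w]"] Union_path_edges[of "w # B @ [u]"] C(1)
    by auto
  show "cimg (u # A @ w # B) = curve (path_edges (u # A @ [w])) \<union> curve (path_edges (w # B @ [u]))"
    by (simp add: cimg_def cycle_edges_split curve_Un)
qed

lemma cycle_loop:
  assumes "graph_cycle E C"
  obtains g where "simple_path g" "pathfinish g = pathstart g" "path_image g = cimg C"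
proof -
  \<comment> \<open>The cycle is cut into its first edge and the path formed by the rest.\<close>
  obtain u w B where C: "C = u # [] @ w # B" using assms
    by (auto simp: graph_cycle_def numeral_3_eq_3 Suc_le_length_iff)
  note * = cycle_halves[OF assms[unfolded C]]
  have d: "distinct (u # w # B)" using assms by (simp add: graph_cycle_def C)
  obtain g where g: "arc g" "pathstart g = u" "pathfinish g = w" "path_image g = curve (path_edges (u # [] @ [w]))"
    using path_arc[OF _ _ *(1)] d by auto
  obtain h where h: "arc h" "pathstart h = w" "pathfinish h = u" "path_image h = curve (path_edges (w # B @ [u]))"
    using path_arc[OF _ _ *(2)] d by auto
  have "simple_path (g +++ h)" using g h *(4) by (intro simple_path_join_loop) auto
  moreover have "path_image (g +++ h) = cimg C"
    using g h *(5) by (simp add: path_image_join C)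
  ultimately show thesis using that[of "g +++ h"] g h by simp
qed

lemma cycle_Jordan:
  assumes "graph_cycle E C"
  shows "inside (cimg C) \<noteq> {}" "open (inside (cimg C))" "connected (inside (cimg C))"
    "open (outside (cimg C))" "connected (outside (cimg C))"
    "bounded (inside (cimg C))" "\<not> bounded (outside (cimg C))"
    "frontier (inside (cimg C)) = cimg C" "frontier (outside (cimg C)) = cimg C"
  using cycle_loop[OF assms] Jordan_inside_outside by metis+

lemma closure_inside: "graph_cycle E C \<Longrightarrow> closure (inside (cimg C)) = disc C"
  using closure_Un_frontier[of "inside (cimg C)"] cycle_Jordan(8) by (auto simp: disc_def)

lemma inner_if_open_edge:
  assumes "graph_cycle E C" "f \<in> E" "img f - f \<subseteq> inside (cimg C)"
  shows "f \<in> inner_edges C"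
  using assms closure_mono[OF assms(3)] open_edge(3)[OF assms(2)]
  by (auto simp: inner_edges_def closure_inside)

lemma open_edge_cimg:
  assumes "graph_cycle E C" "f \<in> E" "f \<notin> cycle_edges C"
  shows "(img f - f) \<inter> cimg C = {}"
  using assms open_edge_curve by (auto simp: graph_cycle_def cimg_def)

text \<open>An open edge off the cycle avoids the closed curve, so within the closed region it can
  only run inside.\<close>

lemma inner_iff:
  assumes "graph_cycle E C"
  shows "f \<in> inner_edges C \<longleftrightarrow> f \<in> cycle_edges C \<or> f \<in> E \<and> img f - f \<subseteq> inside (cimg C)"
proof
  assume "f \<in> inner_edges C"
  then show "f \<in> cycle_edges C \<or> f \<in> E \<and> img f - f \<subseteq> inside (cimg C)"
    using open_edge_cimg[OF assms, of f] by (auto simp: inner_edges_def disc_def)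
next
  assume "f \<in> cycle_edges C \<or> f \<in> E \<and> img f - f \<subseteq> inside (cimg C)"
  then show "f \<in> inner_edges C"
  proof
    assume "f \<in> cycle_edges C"
    then show ?thesis using assms by (auto simp: inner_edges_def disc_def graph_cycle_def cimg_def curve_def)
  qed (use inner_if_open_edge[OF assms] in blast)
qed

lemma inner_subset: "inner_edges C \<subseteq> E" by (auto simp: inner_edges_def)

lemma cycle_edges_inner: "graph_cycle E C \<Longrightarrow> cycle_edges C \<subseteq> inner_edges C"
  using inner_iff by blast

lemma vertices_cimg:
  assumes "graph_cycle E C"
  shows "V \<inter> cimg C = set C"
  using vertices_on_curve[of "cycle_edges C"] assms
  by (simp add: graph_cycle_def cimg_def Union_cycle_edges)

text \<open>The path and the two halves of the cycle are three arcs from \<open>u\<close> to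
  \<open>w\<close> that meet only at their ends. In such a theta curve the arc that runs through the
  inside divides it into the part next to \<open>A\<close> and the part next to
  \<open>B\<close>.\<close>

lemma inside_split:
  assumes "graph_cycle E (u # A @ w # B)" "distinct (u # P @ [w])"
    and "set P \<inter> set (u # A @ w # B) = {}"
    and "path_edges (u # P @ [w]) \<subseteq> E" "path_edges (u # P @ [w]) \<inter> cycle_edges (u # A @ w # B) = {}"
    and "curve (path_edges (u # P @ [w])) \<inter> inside (cimg (u # A @ w # B)) \<noteq> {}"
  shows "graph_cycle E (u # A @ w # rev P)" "graph_cycle E (u # P @ w # B)"
    "cimg (u # A @ w # rev P) = curve (path_edges (u # A @ [w])) \<union> curve (path_edges (u # P @ [w]))"
    "cimg (u # P @ w # B) = curve (path_edges (w # B @ [u])) \<union> curve (path_edges (u # P @ [w]))"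
    "inside (cimg (u # A @ w # rev P)) \<inter> inside (cimg (u # P @ w # B)) = {}"
    "inside (cimg (u # A @ w # rev P)) \<union> inside (cimg (u # P @ w # B)) \<union>
       (curve (path_edges (u # P @ [w])) - {u, w}) = inside (cimg (u # A @ w # B))"
proof -
  let ?C = "u # A @ w # B"
  let ?EA = "path_edges (u # A @ [w])" and ?EB = "path_edges (w # B @ [u])"
    and ?EP = "path_edges (u # P @ [w])"
  have C: "distinct ?C" "3 \<le> length ?C" "cycle_edges ?C \<subseteq> E"
    using assms(1) by (auto simp: graph_cycle_def)
  note halves = cycle_halves[OF assms(1)]
  \<comment> \<open>An empty \<open>P\<close> makes the path the single edge \<open>{u, w}\<close>,
    which is not on the cycle, so \<open>A\<close> and \<open>B\<close> are then non-empty. This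
    gives each new cycle at least three vertices.\<close>
  have ne: "A \<noteq> [] \<or> P \<noteq> []" "B \<noteq> [] \<or> P \<noteq> []"
    using assms(5) by (auto simp: cycle_edges_split insert_commute)
  have revP: "path_edges (w # rev P @ [u]) = ?EP"
    using path_edges_rev[of "u # P @ [w]"] by simp
  have e1: "cycle_edges (u # A @ w # rev P) = ?EA \<union> ?EP"
    by (simp add: cycle_edges_split revP)
  have e2: "cycle_edges (u # P @ w # B) = ?EB \<union> ?EP"
    by (simp add: cycle_edges_split Un_commute)
  show "graph_cycle E (u # A @ w # rev P)"
    using C(1) assms(2-4) halves(1) ne(1) by (auto simp: graph_cycle_def e1 Suc_le_eq numeral_3_eq_3)
  show "graph_cycle E (u # P @ w # B)"
    using C(1) assms(2-4) halves(2) ne(2) by (auto simp: graph_cycle_def e2 Suc_le_eq numeral_3_eq_3)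
  show i1: "cimg (u # A @ w # rev P) = curve ?EA \<union> curve ?EP"
    by (simp add: cimg_def e1 curve_Un)
  show i2: "cimg (u # P @ w # B) = curve ?EB \<union> curve ?EP"
    by (simp add: cimg_def e2 curve_Un)
  obtain c1 where c1: "arc c1" "pathstart c1 = u" "pathfinish c1 = w" "path_image c1 = curve ?EA"
    using path_arc[OF _ _ halves(1)] C(1) by auto
  obtain c2 where c2: "arc c2" "pathstart c2 = w" "pathfinish c2 = u" "path_image c2 = curve ?EB"
    using path_arc[OF _ _ halves(2)] C(1) by auto
  obtain c where c: "arc c" "pathstart c = u" "pathfinish c = w" "path_image c = curve ?EP"
    using path_arc[OF assms(2) _ assms(4)] by auto
  have U: "\<Union>?EA = set (u # A @ [w])" "\<Union>?EB = set (w # B @ [u])" "\<Union>?EP = set (u # P @ [w])"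
    using Union_path_edges[of "u # A @ [w]"] Union_path_edges[of "w # B @ [u]"]
      Union_path_edges[of "u # P @ [w]"] by auto
  have d: "?EA \<inter> ?EP = {}" "?EB \<inter> ?EP = {}"
    using assms(5) by (auto simp: cycle_edges_split)
  have "curve ?EA \<inter> curve ?EP = {u, w}"
    unfolding curve_Int[OF halves(1) assms(4) d(1)] U using assms(2,3) C(1) by auto
  moreover have "curve ?EB \<inter> curve ?EP = {u, w}"
    unfolding curve_Int[OF halves(2) assms(4) d(2)] U using assms(2,3) C(1) by auto
  moreover have "simple_path c1" "simple_path (reversepath c2)" "simple_path c"
    using c1 c2 c by (auto intro: arc_imp_simple_path arc_reversepath)
  moreover have "u \<noteq> w" using assms(2) by simp
  \<comment> \<open>The arc along \<open>B\<close> runs from \<open>w\<close> to \<open>u\<close>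
    and is reversed, since the three arcs must share start and end.\<close>
  ultimately have "inside (path_image c1 \<union> path_image c) \<inter> inside (path_image (reversepath c2) \<union> path_image c) = {} \<and>
      inside (path_image c1 \<union> path_image c) \<union> inside (path_image (reversepath c2) \<union> path_image c) \<union>
        (path_image c - {u, w}) = inside (path_image c1 \<union> path_image (reversepath c2))"
    using c1 c2 c halves(4,5) assms(6)
    by - (rule split_inside_simple_closed_curve[of c1 u w "reversepath c2" c], simp_all)
  then show "inside (cimg (u # A @ w # rev P)) \<inter> inside (cimg (u # P @ w # B)) = {}"
    "inside (cimg (u # A @ w # rev P)) \<union> inside (cimg (u # P @ w # B)) \<union>
       (curve ?EP - {u, w}) = inside (cimg ?C)"
    using c1 c2 c i1 i2 halves(5) by simp_all
qed

text \<open>An open edge inside the cycle and off the path is connected and avoids both new cycles,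
  so it stays in one part. The two closed regions share only the path, which determines their common
  edges and vertices.\<close>

lemma inner_split:
  assumes "graph_cycle E (u # A @ w # B)" "distinct (u # P @ [w])"
    and "set P \<inter> set (u # A @ w # B) = {}"
    and "path_edges (u # P @ [w]) \<subseteq> E" "path_edges (u # P @ [w]) \<inter> cycle_edges (u # A @ w # B) = {}"
    and "curve (path_edges (u # P @ [w])) \<inter> inside (cimg (u # A @ w # B)) \<noteq> {}"
  shows "inner_edges (u # A @ w # B) = inner_edges (u # A @ w # rev P) \<union> inner_edges (u # P @ w # B)"
    "inner_edges (u # A @ w # rev P) \<inter> inner_edges (u # P @ w # B) = path_edges (u # P @ [w])"
    "\<Union>(inner_edges (u # A @ w # rev P)) \<inter> \<Union>(inner_edges (u # P @ w # B)) = set (u # P @ [w])"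
    "inside (cimg (u # P @ w # B)) \<subseteq> inside (cimg (u # A @ w # B))"
proof -
  let ?C = "u # A @ w # B" and ?C1 = "u # A @ w # rev P" and ?C2 = "u # P @ w # B"
  let ?EA = "path_edges (u # A @ [w])" and ?EB = "path_edges (w # B @ [u])"
    and ?EP = "path_edges (u # P @ [w])"
  note halves = cycle_halves[OF assms(1)]
  note sp = inside_split[OF assms]
  have C: "distinct ?C" using assms(1) by (auto simp: graph_cycle_def)
  have U: "\<Union>?EA = set (u # A @ [w])" "\<Union>?EB = set (w # B @ [u])" "\<Union>?EP = set (u # P @ [w])"
    using Union_path_edges[of "u # A @ [w]"] Union_path_edges[of "w # B @ [u]"]
      Union_path_edges[of "u # P @ [w]"] by auto
  show sub: "inside (cimg ?C2) \<subseteq> inside (cimg ?C)" using sp(6) by blast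
  have sub1: "inside (cimg ?C1) \<subseteq> inside (cimg ?C)" using sp(6) by blast
  have uw: "u \<in> curve ?EA" "w \<in> curve ?EA" using halves(4) by auto
  have P_disc: "curve ?EP \<subseteq> disc ?C"
    using sp(6) halves(5) uw by (auto simp: disc_def)
  have "disc ?C1 \<subseteq> disc ?C" "disc ?C2 \<subseteq> disc ?C"
    using sub sub1 P_disc sp(3,4) halves(5) by (auto simp: disc_def)
  then have "inner_edges ?C1 \<union> inner_edges ?C2 \<subseteq> inner_edges ?C" by (auto simp: inner_edges_def)
  moreover have "inner_edges ?C \<subseteq> inner_edges ?C1 \<union> inner_edges ?C2"
  proof
    fix f assume f: "f \<in> inner_edges ?C"
    then have fE: "f \<in> E" using inner_subset by blast
    have cy: "cycle_edges ?C1 \<subseteq> inner_edges ?C1" "cycle_edges ?C2 \<subseteq> inner_edges ?C2"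
      using cycle_edges_inner sp(1,2) by blast+
    show "f \<in> inner_edges ?C1 \<union> inner_edges ?C2"
    proof (cases "f \<in> cycle_edges ?C1 \<union> cycle_edges ?C2")
      case True
      then show ?thesis using cy by blast
    next
      case False
      have "cycle_edges ?C \<union> ?EP \<subseteq> cycle_edges ?C1 \<union> cycle_edges ?C2"
        by (auto simp: cycle_edges_split)
      then have "f \<notin> cycle_edges ?C" "f \<notin> ?EP" using False by auto
      then have "img f - f \<subseteq> inside (cimg ?C)" using f inner_iff[OF assms(1)] by blast
      moreover have "(img f - f) \<inter> curve ?EP = {}"
        using open_edge_curve[OF fE assms(4) \<open>f \<notin> ?EP\<close>] .
      ultimately have "img f - f \<subseteq> inside (cimg ?C1) \<union> inside (cimg ?C2)"
        using sp(6) by blast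
      then have "img f - f \<subseteq> inside (cimg ?C1) \<or> img f - f \<subseteq> inside (cimg ?C2)"
        using connectedD[OF open_edge(1)[OF fE] cycle_Jordan(2)[OF sp(1)] cycle_Jordan(2)[OF sp(2)]] sp(5)
        by blast
      then show ?thesis using inner_if_open_edge sp(1,2) fE by blast
    qed
  qed
  ultimately show "inner_edges ?C = inner_edges ?C1 \<union> inner_edges ?C2" by blast
  have "disc ?C1 \<inter> disc ?C2 \<subseteq> curve ?EP"
  proof -
    have "curve ?EA \<inter> inside (cimg ?C2) = {}" "curve ?EB \<inter> inside (cimg ?C1) = {}"
      using sub sub1 halves(5) inside_no_overlap[of "cimg ?C"] by blast+
    moreover have "curve ?EP \<inter> inside (cimg ?C1) = {}" "curve ?EP \<inter> inside (cimg ?C2) = {}"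
      using sp(3,4) inside_no_overlap[of "cimg ?C1"] inside_no_overlap[of "cimg ?C2"] by blast+
    moreover have "{u, w} \<subseteq> curve ?EP"
      using ends_in_curve[OF assms(4)] U(3) by auto
    \<comment> \<open>\<open>X\<close>, \<open>Y\<close>, \<open>Z\<close> stand for the arcs along
      \<open>A\<close>, \<open>P\<close>, \<open>B\<close>, and \<open>I\<close>, \<open>J\<close>
      for the two insides; \<open>X\<close> and \<open>Z\<close> meet only in \<open>u\<close> and
      \<open>w\<close>, which lie on \<open>Y\<close>.\<close>
    moreover have "(X \<union> Y \<union> I) \<inter> (Z \<union> Y \<union> J) \<subseteq> Y"
      if "X \<inter> J = {}" "Z \<inter> I = {}" "Y \<inter> I = {}" "Y \<inter> J = {}" "I \<inter> J = {}"
        "X \<inter> Z = {u, w}" "{u, w} \<subseteq> Y" for X Y Z I J :: "complex set"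
      using that by auto
    ultimately show ?thesis using sp(5) halves(4) unfolding disc_def sp(3,4) by presburger
  qed
  note discs = this
  show "inner_edges ?C1 \<inter> inner_edges ?C2 = ?EP"
  proof
    show "?EP \<subseteq> inner_edges ?C1 \<inter> inner_edges ?C2"
      using assms(4) sp(3,4) by (auto simp: inner_edges_def disc_def curve_def)
    show "inner_edges ?C1 \<inter> inner_edges ?C2 \<subseteq> ?EP"
    proof
      fix f assume f: "f \<in> inner_edges ?C1 \<inter> inner_edges ?C2"
      then have "f \<in> E" "img f \<subseteq> curve ?EP" using discs by (auto simp: inner_edges_def)
      then show "f \<in> ?EP" using open_edge_curve[OF _ assms(4)] open_edge(2) by blast
    qed
  qed
  show "\<Union>(inner_edges ?C1) \<inter> \<Union>(inner_edges ?C2) = set (u # P @ [w])"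
  proof
    show "set (u # P @ [w]) \<subseteq> \<Union>(inner_edges ?C1) \<inter> \<Union>(inner_edges ?C2)"
      using \<open>inner_edges ?C1 \<inter> inner_edges ?C2 = ?EP\<close> U(3) by blast
    show "\<Union>(inner_edges ?C1) \<inter> \<Union>(inner_edges ?C2) \<subseteq> set (u # P @ [w])"
    proof
      fix p assume "p \<in> \<Union>(inner_edges ?C1) \<inter> \<Union>(inner_edges ?C2)"
      then obtain f g where fg: "p \<in> f" "f \<in> inner_edges ?C1" "p \<in> g" "g \<in> inner_edges ?C2" by blast
      have "f \<in> E" "g \<in> E" "img f \<subseteq> disc ?C1" "img g \<subseteq> disc ?C2"
        using fg by (auto simp: inner_edges_def)
      then have "p \<in> disc ?C1" "p \<in> disc ?C2" "p \<in> V"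
        using ends_in_img[of f] ends_in_img[of g] edge_props(1)[of f] fg(1,3) by blast+
      then show "p \<in> set (u # P @ [w])"
        using discs vertices_on_curve[OF assms(4)] U(3) by auto
    qed
  qed
qed

section \<open>Faces of the drawn graph\<close>

lemma closed_graph: "closed (V \<union> curve E)"
  unfolding curve_def using finite_vertices finite_edges closed_img
  by (intro closed_Un closed_UN finite_imp_closed) auto

lemma interior_graph: "interior (V \<union> curve E) = {}"
proof -
  have "interior (curve E) = {}"
    unfolding curve_def using finite_edges closed_img edge_props(3) interior_arc_image
    by (intro interior_finite_Union_closed) auto
  then show ?thesis
    using finite_vertices by (simp add: interior_closed_Un_empty_interior finite_imp_closed empty_interior_finite)
qed

lemma face_props:
  assumes "F \<in> faces V E \<gamma>"
  shows "connected F" "F \<noteq> {}" "open F" "F \<inter> V = {}" "F \<inter> curve E = {}"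
proof -
  have F: "F \<in> components (- (V \<union> curve E))" using assms by (simp add: faces_def curve_def)
  show "connected F" "F \<noteq> {}" using F in_components_connected in_components_nonempty by blast+
  show "open F" using F closed_graph open_components by blast
  show "F \<inter> V = {}" "F \<inter> curve E = {}" using in_components_subset[OF F] by auto
qed

lemma curve_mono: "D \<subseteq> D' \<Longrightarrow> curve D \<subseteq> curve D'" by (auto simp: curve_def)

lemma cimg_subset: "graph_cycle E C \<Longrightarrow> cimg C \<subseteq> curve E"
  by (auto simp: cimg_def graph_cycle_def intro: curve_mono[THEN subsetD])

text \<open>A face is connected and misses the cycle, so it cannot meet both open sides.\<close>

lemma face_side:
  assumes "F \<in> faces V E \<gamma>" "graph_cycle E C"
  shows "F \<subseteq> inside (cimg C) \<or> F \<subseteq> outside (cimg C)"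
proof -
  have "F \<subseteq> inside (cimg C) \<union> outside (cimg C)"
    using face_props(5)[OF assms(1)] cimg_subset[OF assms(2)] by auto
  then show ?thesis
    using connectedD[OF face_props(1)[OF assms(1)] cycle_Jordan(2)[OF assms(2)] cycle_Jordan(4)[OF assms(2)]]
      inside_Int_outside[of "cimg C"] by blast
qed

text \<open>A connected set that contains \<open>F\<close> and avoids its frontier equals
  \<open>F\<close>. The side of the cycle in which \<open>F\<close> lies is such a set, and
  boundedness tells which side it is.\<close>

lemma face_eq_side:
  assumes "F \<in> faces V E \<gamma>" "graph_cycle E C" "frontier F = cimg C"
  shows "F = (if bounded F then inside (cimg C) else outside (cimg C))"
proof -
  have max: "S \<subseteq> F" if "connected S" "S \<inter> cimg C = {}" "F \<subseteq> S" for S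
    using connected_Int_frontier[of S F] that face_props(2)[OF assms(1)] assms(3) by blast
  have "F = inside (cimg C) \<or> F = outside (cimg C)"
    using face_side[OF assms(1,2)] max[of "inside (cimg C)"] max[of "outside (cimg C)"]
      cycle_Jordan(3,5)[OF assms(2)] inside_no_overlap[of "cimg C"] outside_no_overlap[of "cimg C"]
    by blast
  then show ?thesis using cycle_Jordan(6,7)[OF assms(2)] by auto
qed

end

section \<open>Triangular faces inside a cycle\<close>

locale triangulated = plane_embedding +
  assumes triangular: "\<And>F. F \<in> faces V E \<gamma> \<Longrightarrow> bounded F \<Longrightarrow> \<exists>T. length T = 3 \<and> face_bounded_by E \<gamma> F T"
begin

lemma bounded_face:
  assumes "F \<in> faces V E \<gamma>" "bounded F"
  obtains T where "length T = 3" "graph_cycle E T" "frontier F = cimg T" "F = inside (cimg T)"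
  using triangular[OF assms] face_eq_side[OF assms(1)] assms(2)
  by (auto simp: face_bounded_by_def cimg_def curve_def)

text \<open>Each bounded face is the inside of a triangle, so three vertices determine it.
  Finiteness will make the union of the closures of faces closed.\<close>

lemma finite_bounded_faces: "finite {F \<in> faces V E \<gamma>. bounded F}"
proof (rule finite_subset)
  show "{F \<in> faces V E \<gamma>. bounded F} \<subseteq> (\<lambda>T. inside (cimg T)) ` {T. set T \<subseteq> V \<and> length T = 3}"
  proof
    fix F assume "F \<in> {F \<in> faces V E \<gamma>. bounded F}"
    then have F: "F \<in> faces V E \<gamma>" "bounded F" by auto
    obtain T where T: "length T = 3" "graph_cycle E T" "F = inside (cimg T)"
      by (rule bounded_face[OF F])
    then have "set T \<subseteq> V" using vertices_cimg by blast
    then show "F \<in> (\<lambda>T. inside (cimg T)) ` {T. set T \<subseteq> V \<and> length T = 3}" using T by blast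
  qed
  show "finite ((\<lambda>T. inside (cimg T)) ` {T. set T \<subseteq> V \<and> length T = 3})"
    using finite_lists_length_eq[OF finite_vertices] by simp
qed

text \<open>Faces inside the cycle are dense there because the drawn graph has empty interior, so an
  inner point of \<open>f\<close> lies in the closure of one of them. It is then on the bounding
  triangle, and since different edges meet only in ends, \<open>f\<close> is a side.\<close>

lemma inner_face_at_edge:
  assumes C: "graph_cycle E C" and f: "f \<in> cycle_edges C"
  obtains F T where "F \<in> faces V E \<gamma>" "F \<subseteq> inside (cimg C)" "length T = 3" "graph_cycle E T"
    "frontier F = cimg T" "F = inside (cimg T)" "f \<in> cycle_edges T"
proof -
  let ?\<F> = "{F \<in> faces V E \<gamma>. F \<subseteq> inside (cimg C)}"
  have fE: "f \<in> E" using C f by (auto simp: graph_cycle_def)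
  have fin: "finite ?\<F>"
    by (rule finite_subset[OF _ finite_bounded_faces]) (auto intro: bounded_subset[OF cycle_Jordan(6)[OF C]])
  have "inside (cimg C) \<subseteq> closure (\<Union>?\<F>)"
  proof
    fix q assume q: "q \<in> inside (cimg C)"
    show "q \<in> closure (\<Union>?\<F>)"
    proof (rule ccontr)
      assume "q \<notin> closure (\<Union>?\<F>)"
      \<comment> \<open>A gap left by the faces would be open and so contain a point off the graph;
        the face of that point lies inside the cycle.\<close>
      define U where "U = inside (cimg C) - closure (\<Union>?\<F>)"
      have "open U" "q \<in> U"
        unfolding U_def using q \<open>q \<notin> closure (\<Union>?\<F>)\<close> cycle_Jordan(2)[OF C]
        by (simp_all add: open_Diff)
      then have "\<not> U \<subseteq> V \<union> curve E"
        using interior_maximal[of U "V \<union> curve E"] unfolding interior_graph by auto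
      then obtain r where r: "r \<in> U" "r \<in> - (V \<union> curve E)" by auto
      then have "r \<in> \<Union>(components (- (V \<union> curve E)))" by (simp only: Union_components)
      then obtain F where F: "F \<in> components (- (V \<union> curve E))" "r \<in> F" by (elim UnionE)
      then have F': "F \<in> faces V E \<gamma>" by (simp add: faces_def curve_def)
      have "r \<in> inside (cimg C)" using r(1) by (simp add: U_def)
      then have "r \<notin> outside (cimg C)" using inside_Int_outside[of "cimg C"] by blast
      then have "F \<subseteq> inside (cimg C)" using face_side[OF F' C] F(2) by blast
      then have "r \<in> \<Union>?\<F>" using F' F(2) by blast
      then have "r \<in> closure (\<Union>?\<F>)" by (rule closure_subset[THEN subsetD])
      then show False using r(1) by (simp add: U_def)
    qed
  qed
  then have "disc C \<subseteq> closure (\<Union>?\<F>)"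
    unfolding closure_inside[OF C, symmetric] by (rule closure_minimal) (rule closed_closure)
  moreover have "closed (\<Union>F\<in>?\<F>. closure F)" using fin by (intro closed_UN) auto
  then have "closure (\<Union>?\<F>) \<subseteq> (\<Union>F\<in>?\<F>. closure F)"
    by (intro closure_minimal) (use closure_subset in auto)
  ultimately have dc: "disc C \<subseteq> (\<Union>F\<in>?\<F>. closure F)" by (rule subset_trans)
  \<comment> \<open>An end of \<open>f\<close> would not do, as it may lie on triangles without the
    side \<open>f\<close>.\<close>
  obtain p where p: "p \<in> img f" "p \<notin> f" using open_edge(2)[OF fE] by blast
  then have "p \<in> disc C" using f by (auto simp: disc_def cimg_def curve_def)
  then obtain F where F: "F \<in> faces V E \<gamma>" "F \<subseteq> inside (cimg C)" "p \<in> closure F"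
    using dc by blast
  have "bounded F" by (rule bounded_subset[OF cycle_Jordan(6)[OF C] F(2)])
  obtain T where T: "length T = 3" "graph_cycle E T" "frontier F = cimg T" "F = inside (cimg T)"
    by (rule bounded_face[OF F(1) \<open>bounded F\<close>])
  have "p \<notin> F" using face_props(5)[OF F(1)] p fE by (auto simp: curve_def)
  then have "p \<in> cimg T" using F(3) T(3) closure_Un_frontier[of F] by auto
  then have "f \<in> cycle_edges T"
    using open_edge_cimg[OF T(2) fE] p by auto
  then show thesis using that F T by blast
qed

text \<open>This is the triangle of the face at \<open>{u, v}\<close>. Its sides lie in the closed
  region because the frontier of the face does, and it has no further inner edge because a face
  misses the drawn graph.\<close>

lemma inner_triangle:
  assumes C: "graph_cycle E C" and f: "{u, v} \<in> cycle_edges C"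
  obtains z where "z \<noteq> u" "z \<noteq> v" "{u, z} \<in> inner_edges C" "{v, z} \<in> inner_edges C"
    "inner_edges [u, v, z] = {{u, v}, {u, z}, {v, z}}" "z \<in> set C \<or> z \<in> inside (cimg C)"
proof -
  obtain F T where F: "F \<in> faces V E \<gamma>" "F \<subseteq> inside (cimg C)" and T: "length T = 3" "graph_cycle E T"
    "frontier F = cimg T" "F = inside (cimg T)" "{u, v} \<in> cycle_edges T"
    by (rule inner_face_at_edge[OF assms])
  have uv: "u \<noteq> v" using edge_props(2)[of "{u, v}"] C f by (auto simp: graph_cycle_def)
  obtain a b c where abc: "T = [a, b, c]" using T(1)
    by (auto simp: numeral_3_eq_3 length_Suc_conv)
  have ed: "cycle_edges [p, q, r] = {{p, q}, {p, r}, {q, r}}" for p q r :: complex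
    by (auto simp: cycle_edges_Cons insert_commute)
  obtain z where z: "cycle_edges T = {{u, v}, {u, z}, {v, z}}" "z \<noteq> u" "z \<noteq> v"
  proof -
    have "distinct [a, b, c]" using T(2) by (simp add: graph_cycle_def abc)
    moreover have "{u, v} = {a, b} \<or> {u, v} = {a, c} \<or> {u, v} = {b, c}"
      using T(5) by (simp add: abc ed)
    \<comment> \<open>\<open>{u, v}\<close> may be any of the three sides in either order;
      \<open>z\<close> is the vertex left over.\<close>
    then have "(u = a \<and> v = b \<or> u = b \<and> v = a) \<or> (u = a \<and> v = c \<or> u = c \<and> v = a) \<or>
        (u = b \<and> v = c \<or> u = c \<and> v = b)"
      unfolding doubleton_eq_iff by blast
    ultimately show ?thesis
      using that[of a] that[of b] that[of c] unfolding abc ed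
      by (elim disjE conjE; hypsubst) (auto simp: insert_commute)
  qed
  have sub: "cycle_edges T \<subseteq> inner_edges C"
  proof
    fix g assume g: "g \<in> cycle_edges T"
    then have "g \<in> E" using T(2) by (auto simp: graph_cycle_def)
    have "img g \<subseteq> frontier F" using g T(3) by (auto simp: cimg_def curve_def)
    also have "\<dots> \<subseteq> closure (inside (cimg C))"
      using closure_mono[OF F(2)] by (auto simp: frontier_def)
    finally show "g \<in> inner_edges C" using \<open>g \<in> E\<close> by (simp add: inner_edges_def closure_inside[OF C])
  qed
  have "inner_edges T = cycle_edges T"
  proof
    show "inner_edges T \<subseteq> cycle_edges T"
    proof
      fix g assume g: "g \<in> inner_edges T"
      show "g \<in> cycle_edges T"
      proof (rule ccontr)
        assume "g \<notin> cycle_edges T"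
        then have "g \<in> E" "img g - g \<subseteq> F" using g inner_iff[OF T(2)] T(4) by auto
        then have "img g - g \<subseteq> F \<inter> curve E" by (auto simp: curve_def)
        then show False using open_edge(2)[OF \<open>g \<in> E\<close>] face_props(5)[OF F(1)] by auto
      qed
    qed
  qed (rule cycle_edges_inner[OF T(2)])
  moreover have "inner_edges [u, v, z] = inner_edges T"
    using z(1) by (simp add: inner_edges_def disc_def cimg_def ed)
  moreover have "z \<in> set C \<or> z \<in> inside (cimg C)"
  proof -
    have "{u, z} \<in> inner_edges C" using sub z(1) by auto
    then have "{u, z} \<in> E" "img {u, z} \<subseteq> disc C" by (auto simp: inner_edges_def)
    then have "z \<in> disc C" "z \<in> V" using ends_in_img[of "{u, z}"] edge_props(1)[of "{u, z}"] by blast+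
    then show ?thesis using vertices_cimg[OF C] by (auto simp: disc_def)
  qed
  ultimately show thesis using that[of z] z sub by auto
qed

text \<open>The unbounded face is the whole outside of \<open>C\<close>, and a face misses every
  edge, so no edge leaves the closed region.\<close>

lemma inner_boundary_cycle:
  assumes "boundary_cycle V E \<gamma> C"
  shows "graph_cycle E C" "inner_edges C = E"
proof -
  obtain F where F: "F \<in> faces V E \<gamma>" "\<not> bounded F" "graph_cycle E C" "frontier F = cimg C"
    using assms by (auto simp: boundary_cycle_def face_bounded_by_def cimg_def curve_def)
  then have "F = outside (cimg C)" using face_eq_side[of F C] by simp
  then have "f \<in> inner_edges C" if "f \<in> E" for f
    using face_props(5)[OF F(1)] that union_with_inside[of "cimg C"]
    by (auto simp: inner_edges_def disc_def curve_def)
  then show "graph_cycle E C" "inner_edges C = E" using inner_subset F(3) by auto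
qed

end

section \<open>Chords and fans\<close>

context plane_embedding
begin

lemma inner_edges_cong: "cycle_edges C = cycle_edges C' \<Longrightarrow> inner_edges C = inner_edges C'"
  by (simp add: inner_edges_def disc_def cimg_def)

text \<open>This is the division of the region by a path of one edge, the case
  \<open>P = []\<close>.\<close>

lemma chord_split:
  assumes C: "graph_cycle E (v # A @ z # B)" and ne: "A \<noteq> []" "B \<noteq> []"
    and chord: "{v, z} \<in> inner_edges (v # A @ z # B)"
  shows "graph_cycle E (v # A @ [z])" "graph_cycle E (v # z # B)"
    "inner_edges (v # A @ z # B) = inner_edges (v # A @ [z]) \<union> inner_edges (v # z # B)"
    "inner_edges (v # A @ [z]) \<inter> inner_edges (v # z # B) = {{v, z}}"
    "\<Union>(inner_edges (v # A @ [z])) \<inter> \<Union>(inner_edges (v # z # B)) = {v, z}"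
proof -
  let ?C = "v # A @ z # B"
  have d: "distinct ?C" using C by (simp add: graph_cycle_def)
  \<comment> \<open>As \<open>A\<close> and \<open>B\<close> are non-empty, \<open>v\<close> and
    \<open>z\<close> are not consecutive on the cycle.\<close>
  have "{v, z} \<notin> cycle_edges ?C"
    using path_edge_ends[of v A z] path_edge_ends[of z B v] d ne
    by (auto simp: cycle_edges_split insert_commute)
  then have in_C: "{v, z} \<in> E" "img {v, z} - {v, z} \<subseteq> inside (cimg ?C)"
    using inner_iff[OF C] chord by auto
  then have "img {v, z} \<inter> inside (cimg ?C) \<noteq> {}" using open_edge(2) by blast
  then have *: "path_edges (v # [] @ [z]) \<subseteq> E" "path_edges (v # [] @ [z]) \<inter> cycle_edges ?C = {}"
      "curve (path_edges (v # [] @ [z])) \<inter> inside (cimg ?C) \<noteq> {}"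
    using in_C(1) \<open>{v, z} \<notin> cycle_edges ?C\<close> by (simp_all add: curve_def)
  have "distinct (v # [] @ [z])" "set [] \<inter> set ?C = {}" using d by auto
  note inside_split[OF C this *] inner_split[OF C this *]
  then show "graph_cycle E (v # A @ [z])" "graph_cycle E (v # z # B)"
    "inner_edges (v # A @ z # B) = inner_edges (v # A @ [z]) \<union> inner_edges (v # z # B)"
    "inner_edges (v # A @ [z]) \<inter> inner_edges (v # z # B) = {{v, z}}"
    "\<Union>(inner_edges (v # A @ [z])) \<inter> \<Union>(inner_edges (v # z # B)) = {v, z}"
    by simp_all
qed

end

section \<open>The fan of triangles at a boundary vertex\<close>

context triangulated
begin

text \<open>Triangles at \<open>v\<close> are peeled off one by one, starting at the edge from
  \<open>v\<close> to \<open>last R\<close>. An apex inside the cycle is appended to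
  \<open>R\<close> and that edge is dropped; an apex on the cycle must be \<open>hd R\<close>, as
  \<open>v\<close> has no chord, and ends the fan. Thus \<open>R @ Z\<close> lists the boundary left
  when \<open>v\<close> is deleted; the last alternative is a lone triangle, of which one edge
  remains.\<close>

lemma fan:
  assumes "graph_cycle E (v # R)" "2 \<le> length R"
    and "\<And>z. z \<in> set (butlast (tl R)) \<Longrightarrow> {v, z} \<notin> inner_edges (v # R)"
  shows "\<exists>Z D. distinct (v # R @ Z) \<and> v \<notin> \<Union>D \<and>
      inner_edges (v # R) = D \<union> spokes v (insert (last R) (insert (hd R) (set Z))) \<and>
      (graph_cycle E (R @ Z) \<and> D = inner_edges (R @ Z) \<or> Z = [] \<and> (\<exists>x y. R = [x, y] \<and> D = {{x, y}}))"
  using assms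
proof (induction "card (inner_edges (v # R))" arbitrary: R rule: less_induct)
  case less
  note C = less.prems(1)
  have dist: "distinct (v # R)" using C by (simp add: graph_cycle_def)
  define u where "u = last R"
  obtain w Q where R: "R = w # Q @ [u]"
  proof (cases R)
    case (Cons a R')
    then have "R' \<noteq> []" using less.prems(2) by auto
    then have "R = a # butlast R' @ [u]" by (simp add: u_def Cons)
    then show thesis by (rule that)
  qed (use less.prems(2) in simp)
  have "cycle_edges (v # R) = path_edges (v # (w # Q) @ [u]) \<union> path_edges (u # [] @ [v])"
    using cycle_edges_split[of v "w # Q" u "[]"] by (simp add: R)
  then have "{u, v} \<in> cycle_edges (v # R)" by simp
  then obtain z where z: "z \<noteq> u" "z \<noteq> v" "{u, z} \<in> inner_edges (v # R)" "{v, z} \<in> inner_edges (v # R)"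
    "inner_edges [u, v, z] = {{u, v}, {u, z}, {v, z}}" "z \<in> set (v # R) \<or> z \<in> inside (cimg (v # R))"
    by (rule inner_triangle[OF C])
  show ?case
  proof (cases "z \<in> set (v # R)")
    case False
    then have zin: "z \<in> inside (cimg (v # R))" using z(6) by blast
    have zE: "{u, z} \<in> E" "{v, z} \<in> E" using z(3,4) inner_subset by auto
    let ?C1 = "v # R @ [z]"
    have C': "graph_cycle E (v # (w # Q) @ u # [])" using C by (simp add: R)
    \<comment> \<open>\<open>z\<close> is not a vertex of the cycle, so no edge at \<open>z\<close>
      belongs to it.\<close>
    have "{u, z} \<notin> cycle_edges (v # R)" "{v, z} \<notin> cycle_edges (v # R)"
      using False Union_cycle_edges[of "v # R"] by blast+
    then have "path_edges (v # [z] @ [u]) \<inter> cycle_edges (v # (w # Q) @ u # []) = {}"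
      by (simp add: R insert_commute)
    moreover have "path_edges (v # [z] @ [u]) \<subseteq> E" using zE by (simp add: insert_commute)
    moreover have "z \<in> curve (path_edges (v # [z] @ [u]))"
      using ends_in_img[OF zE(2)] by (simp add: curve_def)
    then have "curve (path_edges (v # [z] @ [u])) \<inter> inside (cimg (v # (w # Q) @ u # [])) \<noteq> {}"
      using zin by (auto simp: R)
    moreover have "distinct (v # [z] @ [u])" "set [z] \<inter> set (v # (w # Q) @ u # []) = {}"
      using dist z(1,2) False by (auto simp: R)
    ultimately have gc: "graph_cycle E (v # (w # Q) @ u # rev [z])"
      and U: "inner_edges (v # (w # Q) @ u # []) =
        inner_edges (v # (w # Q) @ u # rev [z]) \<union> inner_edges (v # [z] @ u # [])"
      and I: "inner_edges (v # (w # Q) @ u # rev [z]) \<inter> inner_edges (v # [z] @ u # []) =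
        path_edges (v # [z] @ [u])"
      using inside_split(1)[OF C'] inner_split(1,2)[OF C'] by blast+
    have comm: "{z, u} = {u, z}" "{u, v} = {v, u}" by (rule insert_commute)+
    have tri: "inner_edges (v # [z] @ u # []) = {{v, u}, {u, z}, {v, z}}"
      using inner_edges_cong[OF cycle_edges_rotate[of "[u]" "[v, z]"]] z(5) comm by simp
    have C1: "graph_cycle E ?C1" using gc by (simp add: R)
    \<comment> \<open>The triangle shares exactly its two sides at \<open>z\<close> with the
      remaining region, so removing it loses only \<open>{v, u}\<close>, and the number of edges
      drops.\<close>
    have I1: "inner_edges ?C1 \<inter> {{v, u}, {u, z}, {v, z}} = {{v, z}, {u, z}}"
      using I unfolding tri by (simp add: R comm(1))
    have "{{v, z}, {u, z}} \<subseteq> inner_edges ?C1" unfolding I1[symmetric] by (rule Int_lower1)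
    then have mem: "{v, z} \<in> inner_edges ?C1" "{u, z} \<in> inner_edges ?C1" by simp_all
    have "inner_edges (v # R) = inner_edges ?C1 \<union> {{v, u}, {u, z}, {v, z}}"
      using U unfolding tri by (simp add: R)
    then have U2: "inner_edges (v # R) = insert {v, u} (inner_edges ?C1)"
      using mem by auto
    have "{v, u} \<noteq> {v, z}" "{v, u} \<noteq> {u, z}" using z(1,2) by (auto simp: doubleton_eq_iff)
    moreover have "{v, u} \<in> {{v, z}, {u, z}}" if "{v, u} \<in> inner_edges ?C1"
      unfolding I1[symmetric] using that by simp
    ultimately have uv: "{v, u} \<notin> inner_edges ?C1" by blast
    have "finite (inner_edges (v # R))" using finite_subset[OF inner_subset finite_edges] .
    then have "card (inner_edges ?C1) < card (inner_edges (v # R))"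
      using uv unfolding U2 by simp
    moreover have "{v, t} \<notin> inner_edges (v # R @ [z])" if "t \<in> set (butlast (tl (R @ [z])))" for t
    proof -
      \<comment> \<open>\<open>u\<close> is now neither first nor last in the list, but its edge to
        \<open>v\<close> has just been removed.\<close>
      have "t = u \<or> t \<in> set (butlast (tl R))" using that by (auto simp: R butlast_append)
      then show ?thesis
      proof
        assume "t \<in> set (butlast (tl R))"
        then show ?thesis using less.prems(3)[of t] unfolding U2 by simp
      qed (use uv in simp)
    qed
    ultimately obtain Z D where ZD: "distinct (v # (R @ [z]) @ Z)" "v \<notin> \<Union>D"
      "inner_edges ?C1 = D \<union> spokes v (insert (last (R @ [z])) (insert (hd (R @ [z])) (set Z)))"
      "graph_cycle E ((R @ [z]) @ Z) \<and> D = inner_edges ((R @ [z]) @ Z) \<or>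
       Z = [] \<and> (\<exists>x y. R @ [z] = [x, y] \<and> D = {{x, y}})"
      using less.hyps[of "R @ [z]"] C1 less.prems(2) by auto
    have "inner_edges (v # R) = D \<union> spokes v (insert (last R) (insert (hd R) (set (z # Z))))"
      using U2 ZD(3) by (simp add: R insert_commute)
    \<comment> \<open>\<open>R @ [z]\<close> has at least three entries, so the lone triangle cannot
      occur here.\<close>
    moreover have "graph_cycle E (R @ z # Z) \<and> D = inner_edges (R @ z # Z)"
      using ZD(4) by (auto simp: R)
    ultimately show ?thesis using ZD(1,2) by (intro exI[of _ "z # Z"] exI[of _ D]) auto
  next
    case True
    \<comment> \<open>An apex in \<open>Q\<close> would be the end of a chord at
      \<open>v\<close>.\<close>
    have "z \<notin> set Q"
      using less.prems(3)[of z] z(4) by (auto simp: R butlast_append)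
    then have zw: "z = w" using True z(1,2) by (auto simp: R)
    have dR: "distinct (v # R @ [])" using dist by simp
    show ?thesis
    proof (cases "Q = []")
      case True
      have "inner_edges (v # R) = inner_edges [u, v, z]"
        by (rule inner_edges_cong) (auto simp: R True zw cycle_edges_Cons insert_commute)
      then have "inner_edges (v # R) = {{w, u}} \<union> spokes v (insert (last R) (insert (hd R) (set [])))"
        unfolding z(5) by (auto simp: R True zw insert_commute)
      then show ?thesis using dR R True by (intro exI[of _ "[]"] exI[of _ "{{w, u}}"]) auto
    next
      case False
      \<comment> \<open>Now \<open>{u, w}\<close> is a chord. Read from \<open>u\<close>, the cycle
        has just \<open>v\<close> on one side of it, so one part is the triangle and the other is
        bounded by \<open>R\<close>.\<close>
      have rot: "cycle_edges (v # R) = cycle_edges (u # [v] @ w # Q)"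
        using cycle_edges_rotate[of "[u]" "v # w # Q"] by (simp add: R)
      have C': "graph_cycle E (u # [v] @ w # Q)"
        using C graph_cycle_rotate[of E "[u]" "v # w # Q"] by (simp add: R)
      have "{u, w} \<in> inner_edges (u # [v] @ w # Q)"
        using z(3) inner_edges_cong[OF rot] zw by simp
      note sp = chord_split[OF C' _ False this]
      have ie: "inner_edges (u # w # Q) = inner_edges R"
        using inner_edges_cong[OF cycle_edges_rotate[of "[u]" "w # Q"]] by (simp add: R)
      have gR: "graph_cycle E R" using sp(2) graph_cycle_rotate[of E "[u]" "w # Q"] by (simp add: R)
      have tri: "inner_edges (u # [v] @ [w]) = {{u, v}, {u, w}, {v, w}}" using z(5) zw by simp
      have "inner_edges (v # R) = {{u, v}, {u, w}, {v, w}} \<union> inner_edges R"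
        using sp(3) inner_edges_cong[OF rot] tri ie by simp
      moreover have "{u, w} \<in> inner_edges R" using sp(4) ie by auto
      ultimately have "inner_edges (v # R) = inner_edges R \<union> spokes v (insert (last R) (insert (hd R) (set [])))"
        by (auto simp: R insert_commute)
      moreover have "v \<notin> \<Union>(inner_edges R)"
      proof
        assume "v \<in> \<Union>(inner_edges R)"
        then have "v \<in> {u, w}" using sp(5) tri ie by auto
        then show False using dist by (auto simp: R)
      qed
      ultimately show ?thesis
        using dR gR by (intro exI[of _ "[]"] exI[of _ "inner_edges R"]) auto
    qed
  qed
qed

end

section \<open>Monomials of near-triangulations\<close>

text \<open>The cycle is rotated until the special edge joins its last two entries \<open>y\<close>
  and \<open>x\<close>; the first entry \<open>v\<close> is then the neighbour of \<open>x\<close>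
  other than \<open>y\<close>, where the inductive step acts.\<close>

lemma cycle_edge_normal_form:
  assumes "e \<in> cycle_edges C" "3 \<le> length C"
  obtains v R x y A B where "C = A @ B" "B @ A = v # R @ [y, x]" "e = {x, y}"
proof -
  obtain i where i: "i < length C" "e = {C ! i, C ! (Suc i mod length C)}"
    using assms(1) by (auto simp: cycle_edges_def)
  show thesis
  proof (cases "Suc i = length C")
    case True
    \<comment> \<open>Here \<open>e\<close> joins the last vertex to the first, so it suffices to
      move the first vertex to the end.\<close>
    obtain x M where C: "C = x # M" using assms(2) by (cases C) auto
    then obtain M' y where M: "M = M' @ [y]" using assms(2) by (cases M rule: rev_cases) auto
    then obtain v R where "M' = v # R" using assms(2) C by (cases M') auto
    moreover have "C ! i = y" "C ! (Suc i mod length C) = x"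
      using True by (simp_all add: C M nth_append)
    ultimately show thesis using that[of "[x]" M v R y x] i(2) by (simp add: C M insert_commute)
  next
    case False
    then have i': "Suc i < length C" using i(1) by simp
    define K L where "K = take i C" and "L = drop (Suc (Suc i)) C"
    define p q where "p = C ! i" and "q = C ! Suc i"
    have C: "C = K @ [p, q] @ L"
      using id_take_nth_drop[OF i(1)] Cons_nth_drop_Suc[OF i'] by (simp add: K_def L_def p_def q_def)
    then have "L @ K \<noteq> []" using assms(2) by auto
    then obtain v R where vR: "L @ K = v # R" by (cases "L @ K") auto
    show thesis
    proof (rule that)
      show "C = (K @ [p, q]) @ L" using C by simp
      show "L @ (K @ [p, q]) = v # R @ [p, q]"
        unfolding append_assoc[symmetric] vR by simp
      show "e = {q, p}" using i(2) i' by (simp add: insert_commute p_def q_def)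
    qed
  qed
qed

text \<open>A non-empty \<open>B\<close> puts \<open>z\<close> at or before \<open>y\<close>, so the
  special edge stays on the side of the chord that follows \<open>z\<close>.\<close>

lemma last_edge_of_suffix:
  assumes "L @ [y, x] = A @ z # B" "B \<noteq> []"
  shows "{y, x} \<in> path_edges (z # B)"
proof -
  obtain B' b where B: "B = B' @ [b]" using assms(2) by (cases B rule: rev_cases) auto
  then have b: "b = x" and eq: "L @ [y] = A @ z # B'" using assms(1) 
    using arg_cong[OF assms(1), of last] arg_cong[OF assms(1), of butlast] by (simp_all add: butlast_append)
  have "last (L @ [y]) = last (z # B')" unfolding eq by simp
  then have "last (z # B') = y" by simp
  then obtain K where "z # B' = K @ [y]" by (metis append_butlast_last_id list.distinct(1))
  then have "z # B = K @ [y, x]" by (simp add: B b)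
  then show ?thesis using path_edges_append[of K y "[x]"] by simp
qed

section \<open>Induction over the regions bounded by cycles\<close>

context triangulated
begin

lemma graph_edges_inner: "graph_edges (inner_edges C - X)"
  using finite_subset[OF inner_subset finite_edges] inner_subset edge_props(2)
  by (auto simp: graph_edges_def)

text \<open>\<open>M1\<close> belongs to the side with \<open>e\<close>, whose product keeps the
  chord; \<open>M2\<close> belongs to the other side, with the chord as special edge. As
  \<open>M2\<close> is zero at \<open>v\<close> and \<open>z\<close>, it is zero on the whole first
  side, so \<open>coefficient_Un\<close> applies and each vertex gets its degree from at most one of
  the two.\<close>

lemma chord_exponent:
  fixes c :: "complex set \<Rightarrow> complex \<Rightarrow> 'k::field"
  assumes C: "graph_cycle E (v # A @ z # B)" and ne: "A \<noteq> []" "B \<noteq> []"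
    and chord: "{v, z} \<in> inner_edges (v # A @ z # B)"
    and e: "e \<in> path_edges (z # B)"
    and M1: "coefficient (edge_product c (inner_edges (v # z # B) - {e})) M1 \<noteq> 0"
      "\<And>p. p \<in> e \<Longrightarrow> deg p M1 = 0" "\<And>p. p \<in> set (v # z # B) \<Longrightarrow> deg p M1 \<le> 2" "\<And>p. deg p M1 \<le> 4"
    and M2: "coefficient (edge_product c (inner_edges (v # A @ [z]) - {{v, z}})) M2 \<noteq> 0"
      "\<And>p. p \<in> {v, z} \<Longrightarrow> deg p M2 = 0" "\<And>p. p \<in> set (v # A @ [z]) \<Longrightarrow> deg p M2 \<le> 2" "\<And>p. deg p M2 \<le> 4"
  shows "\<exists>M. coefficient (edge_product c (inner_edges (v # A @ z # B) - {e})) M \<noteq> 0 \<and>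
     (\<forall>p\<in>e. deg p M = 0) \<and> (\<forall>p\<in>set (v # A @ z # B). deg p M \<le> 2) \<and> (\<forall>p. deg p M \<le> 4)"
proof -
  note sp = chord_split[OF C ne chord]
  let ?I1 = "inner_edges (v # z # B)" and ?I2 = "inner_edges (v # A @ [z])"
  have dist: "distinct (v # A @ z # B)" using C by (simp add: graph_cycle_def)
  have "v \<notin> e" using path_edges_subset[OF e] dist by auto
  then have evz: "e \<noteq> {v, z}" by blast
  have cy1: "cycle_edges (v # z # B) = path_edges (v # z # B @ [v])" by (simp add: cycle_edges_Cons)
  have "path_edges (z # B) \<subseteq> path_edges (z # B @ [v])"
  proof -
    obtain B' b where "B = B' @ [b]" using ne(2) by (cases B rule: rev_cases) auto
    then show ?thesis using path_edges_append[of "z # B'" b "[v]"] by auto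
  qed
  then have "e \<in> cycle_edges (v # z # B)" unfolding cy1 using e by auto
  then have eI: "e \<in> ?I1" using cycle_edges_inner[OF sp(2)] by blast
  then have eI2: "e \<notin> ?I2" using sp(4) evz by blast
  have vz: "{v, z} \<in> ?I1" using sp(4) by blast
  have D: "inner_edges (v # A @ z # B) - {e} = (?I1 - {e}) \<union> (?I2 - {{v, z}})"
    unfolding sp(3) using eI2 vz evz by auto
  have disj: "(?I1 - {e}) \<inter> (?I2 - {{v, z}}) = {}"
    using sp(4) by blast
  \<comment> \<open>The sides share only \<open>v\<close> and \<open>z\<close>, where
    \<open>M2\<close> is zero by assumption; off the second side it is zero by support.\<close>
  have M2_0: "deg p M2 = 0" if "p \<in> \<Union>?I1" for p
  proof (cases "p \<in> \<Union>?I2")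
    case True
    then have "p \<in> {v, z}" using sp(5) that by blast
    then show ?thesis by (rule M2(2))
  next
    case False
    then have "p \<notin> \<Union>(?I2 - {{v, z}})" by blast
    then show ?thesis using coefficient_support[OF graph_edges_inner M2(1)] by blast
  qed
  have M1_0: "deg p M1 = 0" if "p \<notin> \<Union>?I1" for p
  proof -
    have "p \<notin> \<Union>(?I1 - {e})" using that by blast
    then show ?thesis using coefficient_support[OF graph_edges_inner M1(1)] by blast
  qed
  have "coefficient (edge_product c ((?I1 - {e}) \<union> (?I2 - {{v, z}}))) (M1 + M2) =
     coefficient (edge_product c (?I1 - {e})) M1 * coefficient (edge_product c (?I2 - {{v, z}})) M2"
    by (rule coefficient_Un[OF graph_edges_inner graph_edges_inner disj _ M2(1)]) (use M2_0 in blast)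
  then have "coefficient (edge_product c (inner_edges (v # A @ z # B) - {e})) (M1 + M2) \<noteq> 0"
    unfolding D using M1(1) M2(1) by simp
  moreover have "deg p (M1 + M2) = 0" if "p \<in> e" for p
    using M1(2)[OF that] M2_0[of p] eI that by auto
  moreover have "deg p (M1 + M2) \<le> 4" for p
    using M1_0[of p] M2_0[of p] M1(4)[of p] M2(4)[of p] by (cases "p \<in> \<Union>?I1") auto
  moreover have "deg p (M1 + M2) \<le> 2" if p: "p \<in> set (v # A @ z # B)" for p
  proof (cases "p \<in> \<Union>?I1")
    case True
    \<comment> \<open>A boundary vertex of the second side meets the first side only if it is
      \<open>v\<close> or \<open>z\<close>.\<close>
    have "p \<in> set (v # z # B)"
    proof (rule ccontr)
      assume "p \<notin> set (v # z # B)"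
      then have "p \<in> set (v # A @ [z])" using p by auto
      then have "p \<in> \<Union>?I2" using cycle_edges_inner[OF sp(1)] Union_cycle_edges[of "v # A @ [z]"] by blast
      then have "p \<in> {v, z}" using True sp(5) by blast
      then show False using \<open>p \<notin> set (v # z # B)\<close> by auto
    qed
    then show ?thesis using M1(3) M2_0[OF True] by simp
  next
    case False
    then have "p \<notin> set (v # z # B)"
      using cycle_edges_inner[OF sp(2)] Union_cycle_edges[of "v # z # B"] by blast
    then have "p \<in> set (v # A @ [z])" using p by auto
    then show ?thesis using M2(3) M1_0[OF False] by simp
  qed
  ultimately show ?thesis by blast
qed

text \<open>Induction on the number of edges in the region, over all cycles of the fixed embedding
  and all special edges on them. The bound 4 is asked of all points, so interior vertices need not
  be singled out.\<close>

lemma disc_exponent: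
  fixes c :: "complex set \<Rightarrow> complex \<Rightarrow> 'k::field"
  assumes "graph_cycle E C" "e \<in> cycle_edges C"
    and "\<And>f p. f \<in> inner_edges C - {e} \<Longrightarrow> p \<in> f \<Longrightarrow> c f p \<noteq> 0"
  shows "\<exists>M. coefficient (edge_product c (inner_edges C - {e})) M \<noteq> 0 \<and>
     (\<forall>p\<in>e. deg p M = 0) \<and> (\<forall>p\<in>set C. deg p M \<le> 2) \<and> (\<forall>p. deg p M \<le> 4)"
  using assms
proof (induction "card (inner_edges C)" arbitrary: C e rule: less_induct)
  case less
  have "3 \<le> length C" using less.prems(1) by (simp add: graph_cycle_def)
  then obtain v R0 x y A0 B0 where C: "C = A0 @ B0" "B0 @ A0 = v # R0 @ [y, x]" and e: "e = {x, y}"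
    using cycle_edge_normal_form[OF less.prems(2)] by metis
  define R where "R = R0 @ [y, x]"
  have setC: "set C = set (v # R)" using arg_cong[OF C(2), of set] by (auto simp: C(1) R_def)
  have "cycle_edges C = cycle_edges (v # R)"
    using cycle_edges_rotate[of A0 B0] C by (simp add: R_def)
  then have inC: "inner_edges C = inner_edges (v # R)" by (rule inner_edges_cong)
  have gc: "graph_cycle E (v # R)"
    using less.prems(1) graph_cycle_rotate[of E A0 B0] C by (simp add: R_def)
  then have dist: "distinct (v # R)" by (simp add: graph_cycle_def)
  have R: "2 \<le> length R" "last R = x" by (simp_all add: R_def)
  have fin: "finite (inner_edges L)" for L using finite_subset[OF inner_subset finite_edges] .
  have "\<exists>M. coefficient (edge_product c (inner_edges (v # R) - {e})) M \<noteq> 0 \<and>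
     (\<forall>p\<in>e. deg p M = 0) \<and> (\<forall>p\<in>set (v # R). deg p M \<le> 2) \<and> (\<forall>p. deg p M \<le> 4)"
  \<comment> \<open>\<open>butlast (tl R)\<close> omits the two neighbours of \<open>v\<close> on
    the cycle, so such a \<open>z\<close> is the other end of a chord.\<close>
  proof (cases "\<exists>z\<in>set (butlast (tl R)). {v, z} \<in> inner_edges (v # R)")
    case True
    then obtain z where z: "z \<in> set (butlast (tl R))" "{v, z} \<in> inner_edges (v # R)" by blast
    obtain A B where AB: "R = A @ z # B" "A \<noteq> []" "B \<noteq> []"
    proof -
      obtain h T where hT: "R = h # T" using R(1) by (cases R) auto
      then obtain Q l where "T = Q @ [l]" using R(1) by (cases T rule: rev_cases) auto
      then have "R = h # Q @ [l]" "z \<in> set Q" using z(1) hT by simp_all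
      moreover obtain K L where "Q = K @ z # L" using split_list[OF \<open>z \<in> set Q\<close>] by blast
      ultimately show thesis using that[of "h # K" "L @ [l]"] by simp
    qed
    have gc': "graph_cycle E (v # A @ z # B)" and z': "{v, z} \<in> inner_edges (v # A @ z # B)"
      using gc z(2) by (simp_all add: AB)
    note sp = chord_split[OF gc' AB(2,3) z']
    have ie: "inner_edges (v # R) = inner_edges (v # A @ [z]) \<union> inner_edges (v # z # B)"
      using sp(3) by (simp add: AB)
    have eB: "e \<in> path_edges (z # B)"
      using last_edge_of_suffix[OF _ AB(3), of R0 y x A z] AB(1) by (simp add: R_def e insert_commute)
    obtain b B' where B: "B = b # B'" using AB(3) by (cases B) auto
    obtain a A' where A: "A = a # A'" using AB(2) by (cases A) auto
    \<comment> \<open>Each side has a boundary edge that the other lacks, so both have fewer edges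
      than the whole.\<close>
    have "{z, b} \<in> inner_edges (v # z # B)" "{v, a} \<in> inner_edges (v # A @ [z])"
      using cycle_edges_inner[OF sp(2)] cycle_edges_inner[OF sp(1)]
      by (auto simp: cycle_edges_Cons A B)
    moreover have "{z, b} \<noteq> {v, z}" "{v, a} \<noteq> {v, z}"
      using dist by (auto simp: AB A B doubleton_eq_iff)
    ultimately have "{z, b} \<notin> inner_edges (v # A @ [z])" "{v, a} \<notin> inner_edges (v # z # B)"
      using sp(4) by (metis IntI singletonD)+
    then have "inner_edges (v # A @ [z]) \<subset> inner_edges (v # R)"
      "inner_edges (v # z # B) \<subset> inner_edges (v # R)"
      using \<open>{z, b} \<in> inner_edges (v # z # B)\<close> \<open>{v, a} \<in> inner_edges (v # A @ [z])\<close>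
      unfolding ie by (metis UnCI psubsetI Un_upper1 Un_upper2)+
    then have card: "card (inner_edges (v # A @ [z])) < card (inner_edges C)"
      "card (inner_edges (v # z # B)) < card (inner_edges C)"
      unfolding inC by (auto intro: psubset_card_mono fin)
    have vz: "{v, z} \<in> cycle_edges (v # A @ [z])"
      using cycle_edges_split[of v A z "[]"] by (simp add: insert_commute)
    have "v \<notin> e" using dist by (auto simp: e R_def)
    have eC: "e \<in> cycle_edges (v # z # B)"
    proof -
      have "path_edges (z # B) \<subseteq> path_edges ((z # B) @ [v])"
      proof (cases B rule: rev_cases)
        case (snoc B' k)
        then show ?thesis using path_edges_append[of "z # B'" k "[v]"] by auto
      qed simp
      then show ?thesis using eB by (auto simp: cycle_edges_Cons)
    qed
    have "e \<in> inner_edges (v # z # B)" using eC cycle_edges_inner[OF sp(2)] by blast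
    then have eI2: "e \<notin> inner_edges (v # A @ [z])" using sp(4) \<open>v \<notin> e\<close> by blast
    obtain M1 where M1: "coefficient (edge_product c (inner_edges (v # z # B) - {e})) M1 \<noteq> 0"
      "\<And>p. p \<in> e \<Longrightarrow> deg p M1 = 0" "\<And>p. p \<in> set (v # z # B) \<Longrightarrow> deg p M1 \<le> 2" "\<And>p. deg p M1 \<le> 4"
    proof -
      have "c f p \<noteq> 0" if "f \<in> inner_edges (v # z # B) - {e}" "p \<in> f" for f p
        using less.prems(3)[of f p] that unfolding inC ie by blast
      then show thesis using less.hyps[OF card(2) sp(2) eC] that by blast
    qed
    \<comment> \<open>On this side the chord takes the role of \<open>e\<close>.\<close>
    obtain M2 where M2: "coefficient (edge_product c (inner_edges (v # A @ [z]) - {{v, z}})) M2 \<noteq> 0"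
      "\<And>p. p \<in> {v, z} \<Longrightarrow> deg p M2 = 0" "\<And>p. p \<in> set (v # A @ [z]) \<Longrightarrow> deg p M2 \<le> 2" "\<And>p. deg p M2 \<le> 4"
    proof -
      have "c f p \<noteq> 0" if "f \<in> inner_edges (v # A @ [z]) - {{v, z}}" "p \<in> f" for f p
        using less.prems(3)[of f p] that eI2 unfolding inC ie by blast
      then show thesis using less.hyps[OF card(1) sp(1) vz] that by blast
    qed
    show ?thesis
      unfolding AB(1) by (rule chord_exponent[OF gc' AB(2,3) z' eB M1 M2])
  next
    case False
    then have nochord: "{v, z} \<notin> inner_edges (v # R)" if "z \<in> set (butlast (tl R))" for z
      using that by blast
    obtain Z D where ZD: "distinct (v # R @ Z)" "v \<notin> \<Union>D"
      "inner_edges (v # R) = D \<union> spokes v (insert (last R) (insert (hd R) (set Z)))"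
      "graph_cycle E (R @ Z) \<and> D = inner_edges (R @ Z) \<or> Z = [] \<and> (\<exists>x y. R = [x, y] \<and> D = {{x, y}})"
      by (rule fan[OF gc R(1), THEN exE]) (erule nochord, elim exE conjE, rule that)
    define w where "w = hd R"
    have w: "w \<in> set R" "w \<noteq> x" "w \<noteq> v"
      using dist by (cases R0; auto simp: w_def R_def)+
    have vx: "{v, x} \<in> inner_edges (v # R)" "{v, x} \<notin> D" "D \<subseteq> inner_edges (v # R)"
      using ZD(2,3) R(2) by auto
    \<comment> \<open>\<open>y\<close> and \<open>x\<close> stay consecutive, so \<open>e\<close> is
      on the new boundary too.\<close>
    have eRZ: "e \<in> cycle_edges (R @ Z)"
    proof -
      have "cycle_edges (R @ Z) = cycle_edges (y # [] @ x # Z @ R0)"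
        using cycle_edges_rotate[of R0 "y # x # Z"] by (simp add: R_def)
      then show ?thesis using cycle_edges_split[of y "[]" x "Z @ R0"] by (simp add: e insert_commute)
    qed
    have eD: "e \<in> D"
      using ZD(4)
    proof
      assume *: "graph_cycle E (R @ Z) \<and> D = inner_edges (R @ Z)"
      then show ?thesis using eRZ cycle_edges_inner by blast
    qed (auto simp: R_def e)
    have ve: "v \<notin> e" using dist by (auto simp: e R_def)
    then have D: "inner_edges C - {e} = (D - {e}) \<union> spokes v (insert x (insert w (set Z)))"
      unfolding inC ZD(3) R(2) w_def[symmetric] by (auto simp: spokes_def)
    have "\<exists>M. coefficient (edge_product c (D - {e})) M \<noteq> 0 \<and> (\<forall>p\<in>e. deg p M = 0) \<and>
       (\<forall>p\<in>set (R @ Z). deg p M \<le> 2) \<and> (\<forall>p. deg p M \<le> 4)"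
      using ZD(4)
    proof
      assume *: "graph_cycle E (R @ Z) \<and> D = inner_edges (R @ Z)"
      have "card D < card (inner_edges C)"
        unfolding inC using vx fin by (intro psubset_card_mono) auto
      moreover have "c f p \<noteq> 0" if "f \<in> D - {e}" "p \<in> f" for f p
        using less.prems(3)[of f p] that unfolding D by blast
      ultimately show ?thesis using less.hyps[of "R @ Z" e] * eRZ by blast
    next
      assume "Z = [] \<and> (\<exists>x y. R = [x, y] \<and> D = {{x, y}})"
      \<comment> \<open>A lone triangle leaves only \<open>e\<close>, which is not in the product,
        so the constant monomial serves.\<close>
      then have empty: "D - {e} = {}" using eD by auto
      have "coefficient (edge_product c (D - {e})) 0 \<noteq> 0"
        unfolding empty by (simp add: coefficient_empty)
      then show ?thesis by (intro exI[of _ 0]) auto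
    qed
    then obtain M where M: "coefficient (edge_product c (D - {e})) M \<noteq> 0" "deg x M = 0" "deg y M = 0"
      "\<And>p. p \<in> set R \<union> set Z \<Longrightarrow> deg p M \<le> 2" "\<And>p. deg p M \<le> 4"
      by (auto simp: e)
    have gD: "graph_edges (D - {e})"
      using graph_edges_inner[of C "{e}"] unfolding D graph_edges_Un by blast
    have xy: "x \<in> set R" "y \<in> set R" by (simp_all add: R_def)
    have "\<exists>N. coefficient (edge_product c ((D - {e}) \<union> spokes v (insert x (insert w (set Z))))) N \<noteq> 0 \<and>
      deg x N = 0 \<and> deg y N = 0 \<and> (\<forall>p\<in>insert v (set R). deg p N \<le> 2) \<and> (\<forall>p. deg p N \<le> 4)"
    \<comment> \<open>\<open>set R\<close> is the old boundary without \<open>v\<close>; on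
      \<open>Z\<close> the induction gives the bound 2, while only 4 is required.\<close>
    proof (rule spokes_exponent[OF gD _ _ _ _ _ _ _ _ _ _ _ _ _ _ M])
      show "v \<notin> \<Union>(D - {e})" using ZD(2) by blast
      show "c {v, z} p \<noteq> 0" if "z \<in> insert x (insert w (set Z))" "p \<in> {v, z}" for z p
      proof (rule less.prems(3))
        show "{v, z} \<in> inner_edges C - {e}" unfolding D using that(1) by (auto simp: spokes_def)
      qed (rule that(2))
    qed (use ZD(1) xy w in auto)
    then show ?thesis unfolding D[unfolded inC] by (auto simp: e)
  qed
  then show ?case unfolding inC setC .
qed

end

section \<open>From products over increasing pairs to products over edges\<close>

lemma edge_polynomial_eq_edge_product:
  fixes a b :: "'v set \<Rightarrow> 'k::field"
  assumes v: "bij_betw v {1..n} V" and D: "\<And>f. f \<in> D \<Longrightarrow> f \<subseteq> V \<and> card f = 2"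
  obtains c where "edge_polynomial n v D a b = edge_product c D"
    "\<And>f p. c f p = a f \<or> c f p = b f"
proof -
  define I where "I = {(i, j). i \<in> {1..n} \<and> j \<in> {1..n} \<and> i < j \<and> {v i, v j} \<in> D}"
  \<comment> \<open>The end with the smaller index receives \<open>a\<close>. The value
    \<open>b\<close> is also the default elsewhere, so \<open>c f p\<close> is always
    \<open>a f\<close> or \<open>b f\<close> and inherits being non-zero.\<close>
  define c where "c f p = (if \<exists>(i, j)\<in>I. f = {v i, v j} \<and> p = v i then a f else b f)" for f p
  have inj: "i = j" if "v i = v j" "i \<in> {1..n}" "j \<in> {1..n}" for i j
    using inj_onD[OF bij_betw_imp_inj_on[OF v] that] .
  \<comment> \<open>An edge determines the indices of its ends, and exactly one order of them is
    increasing.\<close>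
  have bij: "bij_betw (\<lambda>(i, j). {v i, v j}) I D"
    unfolding bij_betw_def
  proof
    show "inj_on (\<lambda>(i, j). {v i, v j}) I"
    proof (rule inj_onI)
      fix s t assume "s \<in> I" "t \<in> I" and eq: "(case s of (i, j) \<Rightarrow> {v i, v j}) = (case t of (i, j) \<Rightarrow> {v i, v j})"
      then obtain i j k l where st: "s = (i, j)" "t = (k, l)"
        "i \<in> {1..n}" "j \<in> {1..n}" "i < j" "k \<in> {1..n}" "l \<in> {1..n}" "k < l"
        unfolding I_def by blast
      then have "v i = v k \<and> v j = v l \<or> v i = v l \<and> v j = v k" using eq by (simp add: doubleton_eq_iff)
      then show "s = t" using inj[of i k] inj[of j l] inj[of i l] inj[of j k] st by auto
    qed
    show "(\<lambda>(i, j). {v i, v j}) ` I = D"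
    proof
      show "D \<subseteq> (\<lambda>(i, j). {v i, v j}) ` I"
      proof
        fix f assume f: "f \<in> D"
        then obtain p q where pq: "f = {p, q}" "p \<noteq> q" "p \<in> V" "q \<in> V"
          using D[OF f] by (auto simp: card_2_iff)
        have "V = v ` {1..n}" using v by (simp add: bij_betw_def)
        then obtain i j where ij: "p = v i" "q = v j" "i \<in> {1..n}" "j \<in> {1..n}" using pq by auto
        have "i < j \<or> j < i" using pq(2) ij(1,2) by (auto simp: neq_iff[symmetric])
        then show "f \<in> (\<lambda>(i, j). {v i, v j}) ` I"
        proof
          assume "i < j"
          then have "(i, j) \<in> I" using f unfolding pq(1) ij(1,2) by (simp add: I_def ij(3,4)[simplified])
          then show ?thesis unfolding pq(1) ij(1,2) by (rule rev_image_eqI) simp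
        next
          assume "j < i"
          then have "(j, i) \<in> I" using f unfolding pq(1) ij(1,2)
            by (simp add: I_def ij(3,4)[simplified] insert_commute[of "v j" "v i"])
          then show ?thesis unfolding pq(1) ij(1,2) by (rule rev_image_eqI) (simp add: insert_commute)
        qed
      qed
    qed (auto simp: I_def)
  qed
  have factor: "Const (a {v i, v j}) * Var (v i) + Const (b {v i, v j}) * Var (v j) =
      (\<Sum>p\<in>{v i, v j}. Const (c {v i, v j} p) * Var p)" if ij: "(i, j) \<in> I" for i j
  proof -
    have r: "i \<in> {1..n}" "j \<in> {1..n}" "i < j" using ij by (auto simp: I_def)
    then have "v i \<noteq> v j" using inj[of i j] by auto
    moreover have "c {v i, v j} (v i) = a {v i, v j}" using ij by (auto simp: c_def)
    moreover have "c {v i, v j} (v j) = b {v i, v j}"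
    proof -
      \<comment> \<open>No other pair can make \<open>v j\<close> the smaller end, since
        \<open>v\<close> is injective on the indices.\<close>
      have False if "(k, l) \<in> I" "{v i, v j} = {v k, v l}" "v j = v k" for k l
      proof -
        have kl: "k \<in> {1..n}" "l \<in> {1..n}" "k < l" using that(1) by (auto simp: I_def)
        have "v i = v l" using that(2,3) \<open>v i \<noteq> v j\<close> by (auto simp: doubleton_eq_iff)
        then have "i = l" "j = k" using inj[of i l] inj[of j k] r kl that(3) by auto
        then show False using r kl by simp
      qed
      then have nk: "\<not> ({v i, v j} = {v k, v l} \<and> v j = v k)" if "(k, l) \<in> I" for k l
        using that by metis
      have no: "\<not> (case s of (k, l) \<Rightarrow> {v i, v j} = {v k, v l} \<and> v j = v k)" if "s \<in> I" for s
      proof (cases s)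
        case (Pair k l)
        then show ?thesis using nk[of k l] that by auto
      qed
      have "\<not> (\<exists>(k, l)\<in>I. {v i, v j} = {v k, v l} \<and> v j = v k)"
        by (rule notI, erule bexE) (erule notE[OF no])
      then show ?thesis unfolding c_def by (simp only: if_False)
    qed
    ultimately show ?thesis by simp
  qed
  have "edge_polynomial n v D a b =
      (\<Prod>s\<in>I. case s of (i, j) \<Rightarrow> \<Sum>p\<in>{v i, v j}. Const (c {v i, v j} p) * Var p)"
    unfolding edge_polynomial_def I_def[symmetric]
    by (rule prod.cong) (auto simp: factor)
  also have "\<dots> = (\<Prod>s\<in>I. (\<lambda>f. \<Sum>p\<in>f. Const (c f p) * Var p) ((\<lambda>(i, j). {v i, v j}) s))"
    by (rule prod.cong) auto
  also have "\<dots> = edge_product c D"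
    unfolding edge_product_def by (rule prod.reindex_bij_betw[OF bij])
  finally have "edge_polynomial n v D a b = edge_product c D" .
  moreover have "c f p = a f \<or> c f p = b f" for f p by (simp add: c_def)
  ultimately show thesis by (rule that)
qed

theorem theorem6:
  fixes V :: "complex set"
    and E :: "complex set set"
    and \<gamma> :: "complex set \<Rightarrow> real \<Rightarrow> complex"
    and C :: "complex list"
    and n :: nat
    and v :: "nat \<Rightarrow> complex"
    and e :: "complex set"
    and x y :: complex
    and a b :: "complex set \<Rightarrow> 'k::field"
  assumes "near_triangulation V E \<gamma>"
    and "boundary_cycle V E \<gamma> C"
    and "bij_betw v {1..n} V"
    and "e \<in> cycle_edges C" and "e = {x, y}"
    and "\<And>f. f \<in> E - {e} \<Longrightarrow> a f \<noteq> 0 \<and> b f \<noteq> 0"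
  shows "\<exists>M. coefficient (edge_polynomial n v (E - {e}) a b) M \<noteq> 0 \<and>
             deg x M = 0 \<and> deg y M = 0 \<and>
             (\<forall>w \<in> set C. deg w M \<le> 2) \<and>
             (\<forall>u \<in> V - set C. deg u M \<le> 4)"
proof -
  interpret triangulated V E \<gamma>
    using assms(1) by unfold_locales (auto simp: near_triangulation_def)
  \<comment> \<open>Every edge lies in the region bounded by \<open>C\<close>, so the induction
    applies to all of \<open>E\<close>.\<close>
  note C = inner_boundary_cycle[OF assms(2)]
  obtain c where c: "edge_polynomial n v (E - {e}) a b = edge_product c (E - {e})"
    "\<And>f p. c f p = a f \<or> c f p = b f"
    by (rule edge_polynomial_eq_edge_product[OF assms(3), of "E - {e}" a b]) (use edge_props in auto)
  have "c f p \<noteq> 0" if "f \<in> inner_edges C - {e}" for f p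
    using assms(6)[of f] c(2)[of f p] that C(2) by auto
  then obtain M where "coefficient (edge_product c (E - {e})) M \<noteq> 0"
    "\<forall>p\<in>e. deg p M = 0" "\<forall>p\<in>set C. deg p M \<le> 2" "\<forall>p. deg p M \<le> 4"
    using disc_exponent[OF C(1) assms(4), of c] unfolding C(2) by blast
  then show ?thesis using assms(5) c(1) by auto
qed

end
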